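(* Let $K$ be a field of characteristic $0$, let $k\ge2$, and let $f(z)=\sum_{n=0}^\infty a_nz^n\in K[[z]]$ be a $k$-Mahler power series. Then $(a_n)_{n\ge0}$ is $k$-automatic if and only if $\{a_n:n\ge0\}$ is finite.
   Context: $f\in K[[z]]$ is $k$-Mahler if there are $d\ge0$ and polynomials $p_0,\dots,p_d\in K[z]$, not all zero, with $\sum_{i=0}^dp_i(z)f(z^{k^i})=0$. A sequence is $k$-automatic if its $k$-kernel $\{(a_{k^en+r})_{n\ge0}: e\ge0, 0\le r<k^e\}$ is a finite set. *)

theory Defs
  imports "HOL-Computational_Algebra.Polynomial_FPS"
begin

definition mahler_fps :: "nat \<Rightarrow> 'a::field fps \<Rightarrow> bool" where
  "mahler_fps k f \<longleftrightarrow>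
     (\<exists>(d::nat) (p :: nat \<Rightarrow> 'a poly). (\<exists>i\<le>d. p i \<noteq> 0) \<and>
        (\<Sum>i\<le>d. fps_of_poly (p i) * (f oo fps_X ^ (k ^ i))) = 0)"

definition automatic_kernel :: "nat \<Rightarrow> (nat \<Rightarrow> 'a) \<Rightarrow> (nat \<Rightarrow> 'a) set" where
  "automatic_kernel k a = {(\<lambda>n. a (k ^ e * n + r)) | e r. r < k ^ e}"

definition automatic_seq :: "nat \<Rightarrow> (nat \<Rightarrow> 'a) \<Rightarrow> bool" where
  "automatic_seq k a \<longleftrightarrow> finite (automatic_kernel k a)"

end

theory Submission
  imports Defs
begin

text \<open>
  Choose a prime \<open>l\<close> dividing \<open>k\<close> and a place of \<open>K\<close> above \<open>l\<close> whose residue field is algebraic over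
  \<open>F\<^sub>l\<close>. Over such a residue field every \<open>k\<close>-Mahler series is automatic: the coefficient of \<open>f(X)\<close> in its
  equation divides some \<open>N = X\<^sup>u (1 - X\<^sup>M)\<close>, and since \<open>l\<close> divides \<open>k\<close>, \<open>N(X\<^sup>k)\<close> is divisible by \<open>N\<^sup>2\<close> modulo \<open>l\<close>.
  Hence \<open>f / N\<close> satisfies a Mahler equation in which this coefficient is 1, which makes its \<open>k\<close>-kernel finite.

  To pass from residues to values, take among the idempotent relabelings \<open>\<rho>\<close> of the finitely many values
  with \<open>\<rho> \<circ> a\<close> automatic one with the largest image. If \<open>\<rho>\<close> were not the identity, the differences
  \<open>a n - \<rho> (a n)\<close>, rescaled to be integral but not all in the maximal ideal, would have an automatic
  sequence of residues, and these residues would separate further values.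
\<close>

text \<open>The condition that \<open>l\<close> divides \<open>k\<close> is essential: for other
  primes \<open>N(X^k)\<close> vanishes at 1 modulo \<open>l\<close> to the same order as
  \<open>N\<close>, and no second factor \<open>N\<close> appears. The residue field has to be
  algebraic over its prime field because finitely many coefficients then lie in a finite field, and
  both finiteness arguments (a repetition among the powers of \<open>X\<close>, and the bound on the
  kernel) count polynomials of bounded degree over it. As \<open>K\<close> is an arbitrary field of
  characteristic 0, the place comes from Zorn's lemma and its valuation need not be discrete. There
  is no uniformizer, so the values cannot be recovered digit by digit; instead one rescales the
  finitely many differences by a largest one. Such a difference solves the equation of
  \<open>f\<close> only up to a contribution of \<rho> \<circ> a. This is why all equations below
  carry an automatic inhomogeneous term \<open>b\<close>. The quotient by the maximal ideal is never
  formed: power series keep coefficients in \<open>K\<close> and are compared by congruence.\<close>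

unbundle fps_syntax

subsection \<open>Residue places of positive characteristic\<close>

text \<open>A unit is not demanded, so that one notion covers maximal ideals as well as the subrings
  that contain 1.\<close>

definition closed_diff_mult :: "'a::ring set \<Rightarrow> bool" where
  "closed_diff_mult J \<longleftrightarrow> 0 \<in> J \<and> (\<forall>x\<in>J. \<forall>y\<in>J. x - y \<in> J \<and> x * y \<in> J)"

lemma closed_diff_mult_0: "closed_diff_mult J \<Longrightarrow> 0 \<in> J"
  and closed_diff_mult_diff: "closed_diff_mult J \<Longrightarrow> x \<in> J \<Longrightarrow> y \<in> J \<Longrightarrow> x - y \<in> J"
  and closed_diff_mult_mult: "closed_diff_mult J \<Longrightarrow> x \<in> J \<Longrightarrow> y \<in> J \<Longrightarrow> x * y \<in> J"
  by (auto simp: closed_diff_mult_def)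

lemma closed_diff_mult_minus: "closed_diff_mult J \<Longrightarrow> x \<in> J \<Longrightarrow> - x \<in> J"
  using closed_diff_mult_diff[of J 0 x] closed_diff_mult_0[of J] by simp

lemma closed_diff_mult_add: "closed_diff_mult J \<Longrightarrow> x \<in> J \<Longrightarrow> y \<in> J \<Longrightarrow> x + y \<in> J"
  using closed_diff_mult_diff[of J x "- y"] closed_diff_mult_minus[of J y] by simp

lemma closed_diff_mult_sum:
  "closed_diff_mult J \<Longrightarrow> (\<And>i. i \<in> A \<Longrightarrow> f i \<in> J) \<Longrightarrow> sum f A \<in> J"
  by (induction A rule: infinite_finite_induct) (auto simp: closed_diff_mult_0 closed_diff_mult_add)

text \<open>Isolating \<open>1 - c 0\<close> and multiplying by \<open>inverse x ^ m\<close> turns a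
  relation for \<open>x\<close> into a monic equation for its inverse.\<close>

lemma power_of_inverse_relation:
  fixes x :: "'a::field"
  assumes "(\<Sum>j\<le>m. c j * x ^ j) = 1" "c 0 \<noteq> 1" "x \<noteq> 0"
  shows "inverse x ^ m = (\<Sum>j\<in>{1..m}. c j / (1 - c 0) * inverse x ^ (m - j))"
proof -
  have "(\<Sum>j\<le>m. c j * x ^ j) = c 0 + (\<Sum>j\<in>{1..m}. c j * x ^ j)"
    by (simp add: atMost_atLeast0 sum.atLeast_Suc_atMost)
  then have e: "1 - c 0 = (\<Sum>j\<in>{1..m}. c j * x ^ j)"
    unfolding assms(1) by (metis add_diff_cancel_left')
  have "(1 - c 0) * inverse x ^ m = (\<Sum>j\<in>{1..m}. c j * x ^ j * inverse x ^ m)"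
    by (simp add: e sum_distrib_right)
  also have "\<dots> = (\<Sum>j\<in>{1..m}. c j * inverse x ^ (m - j))"
  proof (rule sum.cong[OF refl])
    fix j assume "j \<in> {1..m}"
    then have "inverse x ^ m = inverse x ^ (m - j) * inverse x ^ j"
      by (simp flip: power_add)
    moreover have "x ^ j * inverse x ^ j = 1"
      using assms(3) by (simp flip: power_mult_distrib)
    ultimately show "c j * x ^ j * inverse x ^ m = c j * inverse x ^ (m - j)"
      by (simp add: mult.assoc mult.left_commute)
  qed
  finally have "inverse x ^ m = (\<Sum>j\<in>{1..m}. c j * inverse x ^ (m - j)) / (1 - c 0)"
    using assms(2) by (simp add: field_simps)
  then show ?thesis by (simp add: sum_divide_distrib)
qed

text \<open>The degree reduction of Chevalley's extension argument: the monic equation, multiplied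
  by \<open>y ^ (s - m)\<close>, expresses \<open>y ^ s\<close> by the powers from
  \<open>s - m\<close> to \<open>s - 1\<close>, which is where the conditional coefficient is
  nonzero.\<close>

lemma eliminate_top_term:
  fixes y :: "'a::field"
  assumes "y ^ m = (\<Sum>j\<in>{1..m}. e j * y ^ (m - j))" "m \<le> s" "1 \<le> s"
  shows "(\<Sum>j\<le>s. q j * y ^ j) =
    (\<Sum>j\<le>s - 1. (q j + (if s - m \<le> j then q s * e (s - j) else 0)) * y ^ j)"
proof -
  have "y ^ s = y ^ (s - m) * y ^ m" using assms(2) by (simp flip: power_add)
  also have "\<dots> = (\<Sum>j\<in>{1..m}. e j * y ^ (s - j))"
  proof -
    have "y ^ (s - m) * y ^ (m - j) = y ^ (s - j)" if "j \<in> {1..m}" for j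
      using that assms(2) by (simp flip: power_add)
    then show ?thesis by (simp add: assms(1) sum_distrib_left mult.left_commute)
  qed
  also have "\<dots> = (\<Sum>j\<in>{s - m..<s}. e (s - j) * y ^ j)"
    by (rule sum.reindex_bij_witness[of _ "\<lambda>j. s - j" "\<lambda>j. s - j"]) (use assms(2) in auto)
  finally have ys: "q s * y ^ s = (\<Sum>j\<in>{s - m..<s}. q s * e (s - j) * y ^ j)"
    by (simp add: sum_distrib_left mult.assoc)
  have split: "{..s} = insert s {..s - 1}" "s \<notin> {..s - 1}" using assms(3) by auto
  have "(\<Sum>j\<le>s - 1. (if s - m \<le> j then q s * e (s - j) else 0) * y ^ j)
      = (\<Sum>j\<in>{s - m..<s}. q s * e (s - j) * y ^ j)"
    by (rule sum.mono_neutral_cong_right) (use assms(3) in auto)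
  then show ?thesis unfolding split(1) using split(2) ys
    by (simp add: sum.distrib algebra_simps)
qed

text \<open>Such an \<open>I\<close> is the maximal ideal of a valuation ring whose residue field is algebraic over \<open>F\<^sub>l\<close>.
  Maximality among nonunital subrings, rather than among places, is what forces the residue field to be this small.\<close>

locale residue_place =
  fixes I :: "'a::field_char_0 set" and l :: nat
  assumes prime_l: "prime l"
    and I_closed: "closed_diff_mult I"
    and l_in_I: "of_nat l \<in> I"
    and one_notin_I: "1 \<notin> I"
    and I_maximal: "\<And>J. closed_diff_mult J \<Longrightarrow> I \<subseteq> J \<Longrightarrow> 1 \<notin> J \<Longrightarrow> J = I"
begin

text \<open>The idealizer of \<open>I\<close>, the largest subring of the field in which
  \<open>I\<close> is an ideal. It turns out to be a valuation ring with maximal ideal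
  \<open>I\<close>.\<close>

definition val_ring :: "'a set" where "val_ring = {x. \<forall>i\<in>I. x * i \<in> I}"

lemmas I_0 = closed_diff_mult_0[OF I_closed]
  and I_diff = closed_diff_mult_diff[OF I_closed]
  and I_minus = closed_diff_mult_minus[OF I_closed]
  and I_add = closed_diff_mult_add[OF I_closed]
  and I_mult = closed_diff_mult_mult[OF I_closed]
  and I_sum = closed_diff_mult_sum[OF I_closed]

lemma val_ring_closed: "closed_diff_mult val_ring"
  unfolding closed_diff_mult_def val_ring_def
  by (auto simp: I_0 left_diff_distrib mult.assoc intro: I_diff)

lemma one_in_val_ring: "1 \<in> val_ring"
  by (simp add: val_ring_def)

lemmas val_ring_0 = closed_diff_mult_0[OF val_ring_closed]
  and val_ring_diff = closed_diff_mult_diff[OF val_ring_closed]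
  and val_ring_minus = closed_diff_mult_minus[OF val_ring_closed]
  and val_ring_add = closed_diff_mult_add[OF val_ring_closed]
  and val_ring_mult = closed_diff_mult_mult[OF val_ring_closed]
  and val_ring_sum = closed_diff_mult_sum[OF val_ring_closed]

lemma val_ring_power: "x \<in> val_ring \<Longrightarrow> x ^ n \<in> val_ring"
  by (induction n) (auto simp: one_in_val_ring val_ring_mult)

lemma val_ring_I_mult: "x \<in> val_ring \<Longrightarrow> i \<in> I \<Longrightarrow> x * i \<in> I"
  and I_val_ring_mult: "x \<in> val_ring \<Longrightarrow> i \<in> I \<Longrightarrow> i * x \<in> I"
  by (simp_all add: val_ring_def mult.commute)

lemma I_subset_val_ring: "I \<subseteq> val_ring"
  using I_mult by (auto simp: val_ring_def)

lemma of_nat_in_val_ring: "of_nat n \<in> val_ring"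
  by (induction n) (auto simp: val_ring_0 one_in_val_ring val_ring_add)

lemma of_int_in_val_ring: "of_int n \<in> val_ring"
  by (cases n rule: int_diff_cases) (auto simp: of_nat_in_val_ring val_ring_diff)

text \<open>The fractions with numerator in \<open>I\<close> and denominator in \<open>1 - I\<close>
  form a nonunital subring, since \<open>(1 - b) * (1 - d)\<close> is again of the form
  \<open>1 - i\<close> with \<open>i\<close> in \<open>I\<close>. It omits 1 because
  \<open>a / (1 - b) = 1\<close> would put \<open>1 = a + b\<close> into \<open>I\<close>;
  maximality then identifies it with \<open>I\<close>.\<close>

lemma divide_one_minus_in_I:
  assumes "a \<in> I" "b \<in> I" shows "a / (1 - b) \<in> I"
proof -
  let ?J = "{a / (1 - b) | a b. a \<in> I \<and> b \<in> I}"
  have ne: "1 - b \<noteq> 0" if "b \<in> I" for b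
    using that one_notin_I by auto
  have "closed_diff_mult ?J"
    unfolding closed_diff_mult_def
  proof (intro conjI ballI)
    show "0 \<in> ?J" using I_0 by (auto intro!: exI[of _ 0])
    fix x y assume "x \<in> ?J" "y \<in> ?J"
    then obtain a b c d where h: "x = a / (1 - b)" "y = c / (1 - d)" "a \<in> I" "b \<in> I" "c \<in> I" "d \<in> I"
      by blast
    have den: "b + d - b * d \<in> I" using h by (intro I_add I_diff I_mult)
    have eq: "1 - (b + d - b * d) = (1 - b) * (1 - d)" by (simp add: algebra_simps)
    have "x - y = (a - a * d - (c - c * b)) / (1 - (b + d - b * d))"
      unfolding eq h using ne[OF h(4)] ne[OF h(6)] by (simp add: divide_simps) (simp add: algebra_simps)
    moreover have "a - a * d - (c - c * b) \<in> I" using h by (intro I_add I_diff I_mult)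
    ultimately show "x - y \<in> ?J" using den by blast
    have "x * y = (a * c) / (1 - (b + d - b * d))"
      unfolding eq h by simp
    then show "x * y \<in> ?J" using den h I_mult by blast
  qed
  moreover have "I \<subseteq> ?J"
  proof
    fix x assume "x \<in> I"
    moreover have "x = x / (1 - 0)" by simp
    ultimately show "x \<in> ?J" using I_0 by blast
  qed
  moreover have "1 \<notin> ?J"
  proof
    assume "1 \<in> ?J"
    then obtain a b where h: "1 = a / (1 - b)" "a \<in> I" "b \<in> I" by blast
    then have "a + b = 1" using ne[of b] by (simp add: field_simps)
    then show False using I_add[OF h(2,3)] one_notin_I by simp
  qed
  ultimately have "?J = I" by (rule I_maximal)
  then show ?thesis using assms by blast
qed

text \<open>The relation expresses that the nonunital ring generated by \<open>I\<close> and \<open>x\<close> contains 1.\<close>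

lemma relation_outside:
  assumes "x \<notin> I"
  shows "\<exists>m c n. c 0 \<in> I \<and> (\<forall>j. c j - of_int (n j) \<in> I) \<and> (\<Sum>j\<le>m. c j * x ^ j) = 1"
proof -
  \<comment> \<open>\<open>Z\<close> is the preimage of the prime field. Restricting the
    coefficients to \<open>Z\<close> is what later makes residues algebraic over that prime
    field.\<close>
  define Z where "Z = {c. \<exists>n::int. c - of_int n \<in> I}"
  have I_Z: "i \<in> Z" if "i \<in> I" for i unfolding Z_def using that by (auto intro!: exI[of _ 0])
  have Z_diff: "a - b \<in> Z" if "a \<in> Z" "b \<in> Z" for a b
  proof -
    from that obtain n m where "a - of_int n \<in> I" "b - of_int m \<in> I" unfolding Z_def by blast
    then have "(a - of_int n) - (b - of_int m) \<in> I" by (rule I_diff)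
    then have "a - b - of_int (n - m) \<in> I" by (simp add: algebra_simps)
    then show ?thesis unfolding Z_def by blast
  qed
  have Z_mult: "a * b \<in> Z" if "a \<in> Z" "b \<in> Z" for a b
  proof -
    from that obtain n m where h: "a - of_int n \<in> I" "b - of_int m \<in> I" unfolding Z_def by blast
    have "(a - of_int n) * (b - of_int m) + of_int m * (a - of_int n) + of_int n * (b - of_int m) \<in> I"
      by (intro I_add I_mult val_ring_I_mult of_int_in_val_ring h)
    then have "a * b - of_int (n * m) \<in> I" by (simp add: algebra_simps)
    then show ?thesis unfolding Z_def by blast
  qed
  have Z_closed: "closed_diff_mult Z"
    unfolding closed_diff_mult_def using Z_diff Z_mult I_Z[OF I_0] by blast
  let ?J = "{poly P x | P. coeff P 0 \<in> I \<and> (\<forall>j. coeff P j \<in> Z)}"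
  have "closed_diff_mult ?J"
    unfolding closed_diff_mult_def
  proof (intro conjI ballI)
    show "0 \<in> ?J" using I_0 I_Z by (auto intro!: exI[of _ 0])
    fix y z assume "y \<in> ?J" "z \<in> ?J"
    then obtain P Q where h: "y = poly P x" "z = poly Q x" "coeff P 0 \<in> I" "coeff Q 0 \<in> I"
      "\<And>j. coeff P j \<in> Z" "\<And>j. coeff Q j \<in> Z" by blast
    have "y - z = poly (P - Q) x" "coeff (P - Q) 0 \<in> I" "\<forall>j. coeff (P - Q) j \<in> Z"
      using h by (auto intro: I_diff Z_diff)
    then show "y - z \<in> ?J" by blast
    have "y * z = poly (P * Q) x" "coeff (P * Q) 0 \<in> I" "\<forall>j. coeff (P * Q) j \<in> Z"
      using h by (auto simp: coeff_mult intro!: I_mult closed_diff_mult_sum[OF Z_closed] Z_mult)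
    then show "y * z \<in> ?J" by blast
  qed
  moreover have "I \<subseteq> ?J"
  proof
    fix i assume i: "i \<in> I"
    have "coeff [:i:] j \<in> Z" for j using i I_Z I_0 by (cases j) auto
    moreover have "i = poly [:i:] x" "coeff [:i:] 0 \<in> I" using i by auto
    ultimately show "i \<in> ?J" by blast
  qed
  moreover have "x \<in> ?J"
  proof -
    have "1 \<in> Z" unfolding Z_def using I_0 by (auto intro!: exI[of _ 1])
    then have "coeff [:0, 1:] j \<in> Z" for j :: nat
      using I_Z I_0 by (auto simp: coeff_pCons split: nat.splits)
    moreover have "x = poly [:0, 1:] x" "coeff [:0, 1::'a:] 0 \<in> I" using I_0 by auto
    ultimately show ?thesis by blast
  qed
  ultimately have "1 \<in> ?J" using I_maximal[of ?J] assms by blast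
  then obtain P where P: "1 = poly P x" "coeff P 0 \<in> I" "\<forall>j. coeff P j \<in> Z" by blast
  obtain n where "\<forall>j. coeff P j - of_int (n j) \<in> I"
    using P(3) unfolding Z_def by (auto intro: that dest!: choice)
  then show ?thesis using P by (intro exI[of _ "degree P"] exI[of _ "coeff P"] exI[of _ n]) (simp add: poly_altdef)
qed

text \<open>The denominator \<open>1 - c 0\<close> is congruent to 1, so dividing by it leaves every
  coefficient congruent to the same integer \<open>n j\<close>.\<close>

lemma monic_relation:
  assumes "x \<notin> I"
  shows "\<exists>m n. m \<ge> 1 \<and> (\<exists>e. (\<forall>j. e j - of_int (n j) \<in> I) \<and>
    inverse x ^ m = (\<Sum>j\<in>{1..m}. e j * inverse x ^ (m - j)))"
proof -
  obtain m c n where h: "c 0 \<in> I" "\<And>j. c j - of_int (n j) \<in> I" "(\<Sum>j\<le>m. c j * x ^ j) = 1"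
    using relation_outside[OF assms] by blast
  have c0: "c 0 \<noteq> 1" using h(1) one_notin_I by auto
  have "m \<noteq> 0" using h(3) c0 by (cases m) auto
  moreover have "c j / (1 - c 0) - of_int (n j) \<in> I" for j
  proof -
    have "c j / (1 - c 0) - of_int (n j) = (c j - of_int (n j) + of_int (n j) * c 0) / (1 - c 0)"
      using c0 by (simp add: field_simps)
    also have "\<dots> \<in> I"
      by (intro divide_one_minus_in_I I_add val_ring_I_mult of_int_in_val_ring h)
    finally show ?thesis .
  qed
  moreover have "x \<noteq> 0" using assms I_0 by auto
  ultimately show ?thesis
    using power_of_inverse_relation[OF h(3) c0]
    by (intro exI[of _ m] exI[of _ n] conjI exI[of _ "\<lambda>j. c j / (1 - c 0)"]) auto
qed

text \<open>Chevalley's argument. If 1 lay in the ring of polynomials in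
  \<open>y = inverse x\<close> with coefficients in \<open>I\<close>, take such a relation of least
  degree \<open>s\<close>, and a relation for \<open>x\<close> as in \<open>relation_outside\<close>
  of least degree \<open>m\<close>. Each gives a monic equation for the other variable, so the one
  of larger degree can be shortened. Hence 1 is not in that ring, which by maximality equals
  \<open>I\<close>, and \<open>y\<close> multiplies \<open>I\<close> into itself.\<close>

lemma inverse_in_val_ring:
  assumes "x \<notin> I" shows "inverse x \<in> val_ring"
proof -
  define y where "y = inverse x"
  have x0: "x \<noteq> 0" using assms I_0 by auto
  then have y0: "y \<noteq> 0" and xy: "x = inverse y" by (auto simp: y_def)
  define A where "A m \<longleftrightarrow> (\<exists>c n. c 0 \<in> I \<and> (\<forall>j. c j - of_int (n j) \<in> I) \<and> (\<Sum>j\<le>m. c j * x ^ j) = 1)" for m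
  define B where "B s \<longleftrightarrow> (\<exists>c. (\<forall>j. c j \<in> I) \<and> (\<Sum>j\<le>s. c j * y ^ j) = 1)" for s
  let ?J = "{poly P y | P. \<forall>j. coeff P j \<in> I}"
  have J: "closed_diff_mult ?J"
    unfolding closed_diff_mult_def
  proof (intro conjI ballI)
    show "0 \<in> ?J" using I_0 by (auto intro!: exI[of _ 0])
    fix u v assume "u \<in> ?J" "v \<in> ?J"
    then obtain P Q where h: "u = poly P y" "v = poly Q y"
      "\<And>j. coeff P j \<in> I" "\<And>j. coeff Q j \<in> I" by blast
    have "u - v = poly (P - Q) y" "\<forall>j. coeff (P - Q) j \<in> I"
      using h by (auto intro: I_diff)
    then show "u - v \<in> ?J" by blast
    have "u * v = poly (P * Q) y" "\<forall>j. coeff (P * Q) j \<in> I"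
      using h by (auto simp: coeff_mult intro!: I_mult I_sum)
    then show "u * v \<in> ?J" by blast
  qed
  have sub: "I \<subseteq> ?J"
  proof
    fix i assume i: "i \<in> I"
    have "coeff [:i:] j \<in> I" for j using i I_0 by (cases j) auto
    moreover have "i = poly [:i:] y" by auto
    ultimately show "i \<in> ?J" by blast
  qed
  have "1 \<notin> ?J"
  proof
    assume "1 \<in> ?J"
    then obtain P where "1 = poly P y" "\<forall>j. coeff P j \<in> I" by blast
    then have "B (degree P)" unfolding B_def by (auto simp: poly_altdef)
    then have Bs: "B (LEAST s. B s)" by (rule LeastI)
    obtain m0 where "A m0" using relation_outside[OF assms] unfolding A_def by blast
    then have "A (LEAST m. A m)" by (rule LeastI)
    then obtain c n where c: "c 0 \<in> I" "\<And>j. c j - of_int (n j) \<in> I"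
      "(\<Sum>j\<le>(LEAST m. A m). c j * x ^ j) = 1" unfolding A_def by blast
    obtain q where q: "\<And>j. q j \<in> I" "(\<Sum>j\<le>(LEAST s. B s). q j * y ^ j) = 1"
      using Bs unfolding B_def by blast
    define m where "m = (LEAST m. A m)"
    define s where "s = (LEAST s. B s)"
    have c0: "c 0 \<noteq> 1" "q 0 \<noteq> 1" using c(1) q(1)[of 0] one_notin_I by auto
    have m1: "m \<ge> 1" using c(3) c0 unfolding m_def[symmetric] by (cases m) auto
    have s1: "s \<ge> 1" using q(2) c0 unfolding s_def[symmetric] by (cases s) auto
    have cO: "c j \<in> val_ring" for j
      using val_ring_add[OF subsetD[OF I_subset_val_ring c(2)] of_int_in_val_ring, of j "n j"] by simp
    show False
    proof (cases "m \<le> s")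
      case True
      define e where "e j = c j / (1 - c 0)" for j
      have "y ^ m = (\<Sum>j\<in>{1..m}. e j * y ^ (m - j))"
        using power_of_inverse_relation[OF c(3) c0(1) x0] unfolding y_def m_def e_def by simp
      from eliminate_top_term[OF this True s1, of q] have
        "(\<Sum>j\<le>s - 1. (q j + (if s - m \<le> j then q s * e (s - j) else 0)) * y ^ j) = 1"
        using q(2) unfolding s_def by simp
      moreover have "q s * e j \<in> I" for j
      proof -
        have "q s * e j = (q s * c j) / (1 - c 0)" by (simp add: e_def)
        then show ?thesis using divide_one_minus_in_I[OF I_val_ring_mult[OF cO q(1)] c(1)] by simp
      qed
      then have "\<forall>j. q j + (if s - m \<le> j then q s * e (s - j) else 0) \<in> I"
        using q(1) I_0 by (auto intro!: I_add)
      ultimately have "B (s - 1)"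
        unfolding B_def by (intro exI[of _ "\<lambda>j. q j + (if s - m \<le> j then q s * e (s - j) else 0)"]) blast
      then have "s \<le> s - 1" unfolding s_def by (rule Least_le)
      then show False using s1 by simp
    next
      case False
      define e where "e j = q j / (1 - q 0)" for j
      have eI: "e j \<in> I" for j unfolding e_def by (intro divide_one_minus_in_I q)
      have "x ^ s = (\<Sum>j\<in>{1..s}. e j * x ^ (s - j))"
        using power_of_inverse_relation[OF q(2) c0(2) y0] unfolding xy s_def e_def by simp
      from eliminate_top_term[OF this _ m1, of c] False have
        "(\<Sum>j\<le>m - 1. (c j + (if m - s \<le> j then c m * e (m - j) else 0)) * x ^ j) = 1"
        using c(3) unfolding m_def by simp
      moreover have ce: "(if m - s \<le> j then c m * e (m - j) else 0) \<in> I" for j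
        using eI cO I_0 by (auto intro!: val_ring_I_mult)
      moreover have "c 0 + (if m - s \<le> 0 then c m * e (m - 0) else 0) \<in> I"
        using ce[of 0] c(1) by (intro I_add) auto
      \<comment> \<open>All corrections lie in \<open>I\<close>, so the shortened relation has the
        same integer witnesses \<open>n\<close> and a constant term still in
        \<open>I\<close>.\<close>
      moreover have "\<forall>j. c j + (if m - s \<le> j then c m * e (m - j) else 0) - of_int (n j) \<in> I"
      proof
        fix j
        show "c j + (if m - s \<le> j then c m * e (m - j) else 0) - of_int (n j) \<in> I"
          using I_add[OF c(2) ce, of j j] by (simp only: algebra_simps)
      qed
      ultimately have "A (m - 1)"
        unfolding A_def
        by (intro exI[of _ "\<lambda>j. c j + (if m - s \<le> j then c m * e (m - j) else 0)"] exI[of _ n]) blast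
      then have "m \<le> m - 1" unfolding m_def by (rule Least_le)
      then show False using m1 by simp
    qed
  qed
  then have JI: "?J = I" using I_maximal[OF J sub] by blast
  have "y * i \<in> I" if "i \<in> I" for i
  proof -
    have "coeff [:0, i:] j \<in> I" for j
      using that I_0 by (auto simp: coeff_pCons split: nat.splits)
    moreover have "y * i = poly [:0, i:] y" by simp
    ultimately have "y * i \<in> ?J" by blast
    then show ?thesis using JI by simp
  qed
  then show ?thesis by (simp add: val_ring_def y_def)
qed

lemma val_ring_total: "x \<in> val_ring \<or> inverse x \<in> I"
  using inverse_in_val_ring[of "inverse x"] by auto

text \<open>This is the algebraicity of the residue field over its prime field. For \<open>x\<close>
  outside \<open>I\<close>, the inverse of \<open>x\<close> is not in \<open>I\<close> either, and
  the monic equation attached to that inverse is one for \<open>x\<close>.\<close>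

lemma val_ring_integral_mod:
  assumes "x \<in> val_ring"
  shows "\<exists>m (n :: nat \<Rightarrow> int). m \<ge> 1 \<and> x ^ m - (\<Sum>j<m. of_int (n j) * x ^ j) \<in> I"
proof (cases "x \<in> I")
  case True
  then show ?thesis by (intro exI[of _ 1] exI[of _ "\<lambda>_. 0"]) simp
next
  case False
  have x0: "x \<noteq> 0" using False I_0 by auto
  have "inverse x \<notin> I"
    using val_ring_I_mult[OF assms, of "inverse x"] x0 one_notin_I by auto
  from monic_relation[OF this] obtain m n e where h: "m \<ge> 1" "\<And>j. e j - of_int (n j) \<in> I"
    "x ^ m = (\<Sum>j\<in>{1..m}. e j * x ^ (m - j))" by auto
  have "(\<Sum>j\<in>{1..m}. e j * x ^ (m - j)) = (\<Sum>j<m. e (m - j) * x ^ j)"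
    by (rule sum.reindex_bij_witness[of _ "\<lambda>j. m - j" "\<lambda>j. m - j"]) auto
  then have "x ^ m - (\<Sum>j<m. of_int (n (m - j)) * x ^ j) = (\<Sum>j<m. (e (m - j) - of_int (n (m - j))) * x ^ j)"
    using h(3) by (simp add: sum_subtractf algebra_simps)
  also have "\<dots> \<in> I" using h(2) assms by (intro I_sum I_val_ring_mult val_ring_power)
  finally show ?thesis using h(1) by (intro exI[of _ m] exI[of _ "\<lambda>j. n (m - j)"]) simp
qed

text \<open>Divisibility in a valuation ring is total, so a finite set has an element
  \<open>s\<close> of largest absolute value. That \<open>s\<close> belongs to \<open>C\<close>
  matters: one of the quotients is then exactly 1, hence not in \<open>I\<close>.\<close>

lemma scale_into_val_ring:
  assumes "finite C" "\<exists>c\<in>C. c \<noteq> 0"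
  shows "\<exists>s\<in>C. s \<noteq> 0 \<and> (\<forall>c\<in>C. c / s \<in> val_ring)"
  using assms
proof (induction C rule: finite_induct)
  case (insert x F)
  show ?case
  proof (cases "\<exists>c\<in>F. c \<noteq> 0")
    case False
    then show ?thesis using insert.prems by (auto intro!: bexI[of _ x] simp: one_in_val_ring val_ring_0)
  next
    case True
    then obtain s where s: "s \<in> F" "s \<noteq> 0" "\<forall>c\<in>F. c / s \<in> val_ring" using insert.IH by blast
    show ?thesis
    proof (cases "x / s \<in> val_ring")
      case True
      then show ?thesis using s by (intro bexI[of _ s]) auto
    next
      case xs: False
      then have x0: "x \<noteq> 0" using val_ring_0 by auto
      have "s / x \<in> val_ring" using val_ring_total[of "x / s"] xs I_subset_val_ring
        by (auto simp: inverse_eq_divide)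
      then have "c / x \<in> val_ring" if "c \<in> F" for c
        using val_ring_mult[of "c / s" "s / x"] s that by auto
      then show ?thesis using x0 by (intro bexI[of _ x]) (auto simp: one_in_val_ring)
    qed
  qed
qed auto

section \<open>Residue classes, and subrings with finite image in the residue field\<close>

definition residue :: "'a \<Rightarrow> 'a set" where "residue x = {y. y - x \<in> I}"

lemma residue_eq_iff: "residue x = residue y \<longleftrightarrow> x - y \<in> I"
proof
  assume "residue x = residue y"
  moreover have "x \<in> residue x" using I_0 by (simp add: residue_def)
  ultimately show "x - y \<in> I" by (simp add: residue_def)
next
  assume h: "x - y \<in> I"
  have "z - x \<in> I \<longleftrightarrow> z - y \<in> I" for z
    using I_add[OF _ h, of "z - x"] I_diff[OF _ h, of "z - y"] by auto
  then show "residue x = residue y" by (simp add: residue_def)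
qed

text \<open>Stands in for a finite subfield of the residue field, lifted to a subring of
  \<open>val_ring\<close> so that all computations stay in the field itself.\<close>

definition res_finite_ring :: "'a set \<Rightarrow> bool" where
  "res_finite_ring B \<longleftrightarrow> closed_diff_mult B \<and> 1 \<in> B \<and> B \<subseteq> val_ring \<and> finite (residue ` B)"

lemma Ints_res_finite_ring: "res_finite_ring \<int>"
  unfolding res_finite_ring_def
proof (intro conjI)
  show "closed_diff_mult (\<int> :: 'a set)" by (simp add: closed_diff_mult_def)
  show "(1::'a) \<in> \<int>" by simp
  show "\<int> \<subseteq> val_ring" using of_int_in_val_ring by (auto simp: Ints_def)
  have "residue (of_int n) = residue (of_int (n mod int l))" for n
  proof -
    have "of_int n - of_int (n mod int l) = (of_int (n div int l) * of_nat l :: 'a)"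
      by (metis add_diff_cancel_right' div_mult_mod_eq of_int_diff of_int_mult of_int_of_nat_eq)
    also have "\<dots> \<in> I" by (intro val_ring_I_mult of_int_in_val_ring l_in_I)
    finally show ?thesis by (simp add: residue_eq_iff)
  qed
  moreover have "n mod int l \<in> {0..<int l}" for n using prime_gt_0_nat[OF prime_l] by simp
  ultimately have "residue (of_int n) \<in> (\<lambda>n. residue (of_int n)) ` {0..<int l}" for n
    by (metis imageI)
  then have "residue ` \<int> \<subseteq> (\<lambda>n. residue (of_int n)) ` {0..<int l}"
    by (auto simp: Ints_def)
  then show "finite (residue ` \<int>)" by (rule finite_subset) simp
qed

text \<open>Modulo \<open>I\<close> the element \<open>x\<close> is a root of a monic integer
  polynomial of some degree \<open>m\<close>, so every polynomial in \<open>x\<close> reduces to one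
  of degree below \<open>m\<close> with coefficients in \<open>B\<close>. Only finitely many
  residues of such coefficients exist.\<close>

lemma res_finite_ring_adjoin:
  assumes B: "res_finite_ring B" and x: "x \<in> val_ring"
  shows "\<exists>B'. res_finite_ring B' \<and> B \<subseteq> B' \<and> x \<in> B'"
proof -
  let ?B = "{poly P x | P. \<forall>j. coeff P j \<in> B}"
  have Bc: "closed_diff_mult B" and B1: "1 \<in> B" and BO: "B \<subseteq> val_ring" and Bf: "finite (residue ` B)"
    using B by (auto simp: res_finite_ring_def)
  note B0 = closed_diff_mult_0[OF Bc] and B_add = closed_diff_mult_add[OF Bc]
    and B_mult = closed_diff_mult_mult[OF Bc]
  have B_int: "of_int n \<in> B" for n
  proof -
    have "of_nat k \<in> B" for k by (induction k) (auto simp: B0 B1 B_add)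
    then show ?thesis by (cases n rule: int_diff_cases) (auto intro: closed_diff_mult_diff[OF Bc])
  qed
  have c: "closed_diff_mult ?B"
    unfolding closed_diff_mult_def
  proof (intro conjI ballI)
    show "0 \<in> ?B" using B0 by (auto intro!: exI[of _ 0])
    fix u v assume "u \<in> ?B" "v \<in> ?B"
    then obtain P Q where h: "u = poly P x" "v = poly Q x"
      "\<And>j. coeff P j \<in> B" "\<And>j. coeff Q j \<in> B" by blast
    have "u - v = poly (P - Q) x" "\<forall>j. coeff (P - Q) j \<in> B"
      using h by (auto intro: closed_diff_mult_diff[OF Bc])
    then show "u - v \<in> ?B" by blast
    have "u * v = poly (P * Q) x" "\<forall>j. coeff (P * Q) j \<in> B"
      using h by (auto simp: coeff_mult intro!: B_mult closed_diff_mult_sum[OF Bc])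
    then show "u * v \<in> ?B" by blast
  qed
  have sub: "B \<subseteq> ?B"
  proof
    fix b assume b: "b \<in> B"
    have "coeff [:b:] j \<in> B" for j using b B0 by (cases j) auto
    moreover have "b = poly [:b:] x" by auto
    ultimately show "b \<in> ?B" by blast
  qed
  have xB: "x \<in> ?B"
  proof -
    have "coeff [:0, 1:] j \<in> B" for j using B1 B0 by (auto simp: coeff_pCons split: nat.splits)
    moreover have "x = poly [:0, 1:] x" by simp
    ultimately show ?thesis by blast
  qed
  have BO': "?B \<subseteq> val_ring"
    using BO x by (auto simp: poly_altdef intro!: val_ring_sum val_ring_mult val_ring_power)
  obtain m n where m: "m \<ge> 1" "x ^ m - (\<Sum>j<m. of_int (n j) * x ^ j) \<in> I"
    using val_ring_integral_mod[OF x] by blast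
  then obtain m' where m': "m = Suc m'" by (cases m) auto
  have red: "\<exists>b. (\<forall>j. b j \<in> B) \<and> poly P x - (\<Sum>j<m. b j * x ^ j) \<in> I"
    if "\<forall>j. coeff P j \<in> B" for P
    using that
  proof (induction P)
    case 0
    then show ?case using B0 I_0 by (intro exI[of _ "\<lambda>_. 0"]) auto
  next
    case (pCons a P)
    have "\<forall>j. coeff P j \<in> B" using pCons.prems by (metis coeff_pCons_Suc)
    then obtain b where b: "\<And>j. b j \<in> B" "poly P x - (\<Sum>j<m. b j * x ^ j) \<in> I"
      using pCons.IH by blast
    have a: "a \<in> B" using pCons.prems by (metis coeff_pCons_0)
    \<comment> \<open>Horner step: multiplication by \<open>x\<close> shifts the coefficients up,
      the overflow \<open>b m' * x ^ m\<close> is replaced by means of the monic relation, and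
      \<open>a\<close> becomes the constant term.\<close>
    define b' where "b' j = (if j = 0 then a else b (j - 1)) + b m' * of_int (n j)" for j
    have "(\<Sum>j<m. b' j * x ^ j) = (\<Sum>j<m. (if j = 0 then a else b (j - 1)) * x ^ j)
        + b m' * (\<Sum>j<m. of_int (n j) * x ^ j)"
      by (simp add: b'_def sum.distrib sum_distrib_left algebra_simps)
    also have "(\<Sum>j<m. (if j = 0 then a else b (j - 1)) * x ^ j) = a + (\<Sum>j<m'. b j * x ^ Suc j)"
      unfolding m' sum.lessThan_Suc_shift by simp
    finally have b': "(\<Sum>j<m. b' j * x ^ j) = a + (\<Sum>j<m'. b j * x ^ Suc j)
        + b m' * (\<Sum>j<m. of_int (n j) * x ^ j)" .
    have xb: "x * (\<Sum>j<m. b j * x ^ j) = (\<Sum>j<m'. b j * x ^ Suc j) + b m' * x ^ m"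
      unfolding m' by (simp add: sum_distrib_left algebra_simps)
    have "poly (pCons a P) x - (\<Sum>j<m. b' j * x ^ j) =
        x * (poly P x - (\<Sum>j<m. b j * x ^ j)) + b m' * (x ^ m - (\<Sum>j<m. of_int (n j) * x ^ j))"
      unfolding b' right_diff_distrib xb by (simp add: algebra_simps)
    also have "\<dots> \<in> I" using b BO x m(2) by (intro I_add val_ring_I_mult) auto
    finally show ?case using a b(1) B_int
      by (intro exI[of _ b']) (auto simp: b'_def intro!: B_add B_mult)
  qed
  \<comment> \<open>\<open>T\<close> holds finitely many representatives of the residues of
    \<open>B\<close>; replacing coefficients by representatives does not change the residue of the
    value.\<close>
  obtain T where T: "finite T" "T \<subseteq> B" "residue ` B = residue ` T"
    using Bf by (metis finite_subset_image subset_refl)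
  have "residue ` ?B \<subseteq> (\<lambda>t. residue (\<Sum>j<m. t j * x ^ j)) ` ({..<m} \<rightarrow>\<^sub>E T)"
  proof
    fix r assume "r \<in> residue ` ?B"
    then obtain P where P: "r = residue (poly P x)" "\<forall>j. coeff P j \<in> B" by blast
    obtain b where b: "\<And>j. b j \<in> B" "poly P x - (\<Sum>j<m. b j * x ^ j) \<in> I" using red[OF P(2)] by blast
    have "\<exists>t\<in>T. residue (b j) = residue t" for j using b(1)[of j] T(3) by (metis imageE imageI)
    then obtain t where t: "\<And>j. t j \<in> T" "\<And>j. residue (b j) = residue (t j)" by metis
    have "(\<Sum>j<m. b j * x ^ j) - (\<Sum>j<m. t j * x ^ j) = (\<Sum>j<m. (b j - t j) * x ^ j)"
      by (simp add: sum_subtractf algebra_simps)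
    also have "\<dots> \<in> I" using t(2) x by (intro I_sum I_val_ring_mult val_ring_power) (auto simp: residue_eq_iff)
    finally have "residue (\<Sum>j<m. b j * x ^ j) = residue (\<Sum>j<m. t j * x ^ j)" by (simp add: residue_eq_iff)
    then have "r = residue (\<Sum>j<m. t j * x ^ j)" using P(1) b(2) by (simp add: residue_eq_iff[symmetric])
    also have "(\<Sum>j<m. t j * x ^ j) = (\<Sum>j<m. restrict t {..<m} j * x ^ j)" by simp
    finally show "r \<in> (\<lambda>t. residue (\<Sum>j<m. t j * x ^ j)) ` ({..<m} \<rightarrow>\<^sub>E T)"
      using t(1) by (intro image_eqI[of _ _ "restrict t {..<m}"]) auto
  qed
  then have "finite (residue ` ?B)" by (rule finite_subset) (auto intro!: finite_imageI finite_PiE T(1))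
  then have "res_finite_ring ?B" using c subsetD[OF sub B1] BO' unfolding res_finite_ring_def by blast
  then show ?thesis using sub xB by blast
qed

lemma res_finite_ring_containing:
  assumes "finite C" "C \<subseteq> val_ring"
  shows "\<exists>B. res_finite_ring B \<and> C \<subseteq> B"
  using assms
proof (induction C rule: finite_induct)
  case empty
  then show ?case using Ints_res_finite_ring by blast
next
  case (insert x F)
  then obtain B where "res_finite_ring B" "F \<subseteq> B" by auto
  with res_finite_ring_adjoin[of B x] insert.prems show ?case by blast
qed

end

text \<open>Zorn's lemma, started at the integer multiples of \<open>l\<close>. These omit 1 because
  the integers embed in characteristic 0 and \<open>l > 1\<close>; unions of nonempty chains keep
  all three conditions.\<close>

lemma residue_place_exists:
  assumes "prime l"
  shows "\<exists>I :: 'a::field_char_0 set. residue_place I l"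
proof -
  define S where "S = {J :: 'a set. closed_diff_mult J \<and> of_nat l \<in> J \<and> 1 \<notin> J}"
  have "range (\<lambda>n::int. of_int n * of_nat l) \<in> S"
    unfolding S_def closed_diff_mult_def
  proof (intro CollectI conjI ballI)
    let ?R = "range (\<lambda>n::int. of_int n * of_nat l :: 'a)"
    show "0 \<in> ?R" by (auto intro!: image_eqI[of _ _ 0])
    show "of_nat l \<in> ?R" by (auto intro!: image_eqI[of _ _ 1])
    show "1 \<notin> ?R"
    proof
      assume "1 \<in> ?R"
      then obtain n :: int where "of_int (n * int l) = (of_int 1 :: 'a)" by auto
      then have "n * int l = 1" unfolding of_int_eq_iff .
      then have "int l dvd 1" by (metis dvd_triv_right)
      then show False using prime_gt_1_nat[OF assms] by simp
    qed
    fix x y assume "x \<in> ?R" "y \<in> ?R"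
    then obtain n m :: int where h: "x = of_int n * of_nat l" "y = of_int m * of_nat l" by auto
    have "x - y = of_int (n - m) * of_nat l" unfolding h by (simp add: algebra_simps)
    then show "x - y \<in> ?R" by blast
    have "x * y = of_int (n * m * int l) * of_nat l" unfolding h by (simp add: algebra_simps)
    then show "x * y \<in> ?R" by blast
  qed
  then have ne: "S \<noteq> {}" by blast
  have "\<exists>M\<in>S. \<forall>X\<in>S. M \<subseteq> X \<longrightarrow> X = M"
  proof (rule subset_Zorn_nonempty[OF ne])
    fix C assume C: "C \<noteq> {}" "subset.chain S C"
    then have CS: "C \<subseteq> S" and Cc: "\<And>X Y. X \<in> C \<Longrightarrow> Y \<in> C \<Longrightarrow> X \<subseteq> Y \<or> Y \<subseteq> X"
      by (auto simp: subset.chain_def)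
    show "\<Union>C \<in> S"
      unfolding S_def closed_diff_mult_def
    proof (intro CollectI conjI ballI)
      show "0 \<in> \<Union>C" "of_nat l \<in> \<Union>C" "1 \<notin> \<Union>C"
        using C(1) CS by (auto simp: S_def closed_diff_mult_def)
      fix x y assume "x \<in> \<Union>C" "y \<in> \<Union>C"
      then obtain X where "X \<in> C" "x \<in> X" "y \<in> X" using Cc by blast
      moreover then have "closed_diff_mult X" using CS by (auto simp: S_def)
      ultimately show "x - y \<in> \<Union>C" "x * y \<in> \<Union>C" by (auto simp: closed_diff_mult_def)
    qed
  qed
  then obtain M where "M \<in> S" "\<And>X. X \<in> S \<Longrightarrow> M \<subseteq> X \<Longrightarrow> X = M" by blast
  then have "residue_place M l"
    using assms by unfold_locales (auto simp: S_def)
  then show ?thesis by blast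
qed

subsection \<open>Automatic sequences and dilation of power series\<close>

text \<open>Closure under the \<open>k\<close> one-digit sections suffices, since an
  \<open>e\<close>-digit section is a composition of \<open>e\<close> of them. The digit split off
  is the most significant one, \<open>r1\<close>.\<close>

lemma automatic_seqI:
  assumes "finite S" "a \<in> S" "\<And>s r. s \<in> S \<Longrightarrow> r < k \<Longrightarrow> (\<lambda>n. s (k * n + r)) \<in> S"
  shows "automatic_seq k a"
proof -
  have "(\<lambda>n. a (k ^ e * n + r)) \<in> S" if "r < k ^ e" for e r
    using that
  proof (induction e arbitrary: r)
    case 0
    then show ?case using assms(2) by simp
  next
    case (Suc e)
    then have k: "k > 0" by (cases k) auto
    define r0 r1 where "r0 = r mod k ^ e" and "r1 = r div k ^ e"
    have r: "r = k ^ e * r1 + r0" by (simp add: r0_def r1_def)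
    have "r1 < k" using Suc.prems unfolding r1_def by (simp add: less_mult_imp_div_less)
    moreover have "(\<lambda>n. a (k ^ e * n + r0)) \<in> S" by (rule Suc.IH) (use k in \<open>simp add: r0_def\<close>)
    ultimately have "(\<lambda>n. a (k ^ e * (k * n + r1) + r0)) \<in> S" by (rule assms(3)[rotated])
    moreover have "k ^ e * (k * n + r1) + r0 = k ^ Suc e * n + r" for n
      unfolding r by (simp add: algebra_simps)
    ultimately show ?case by simp
  qed
  then have "automatic_kernel k a \<subseteq> S" by (auto simp: automatic_kernel_def)
  then show ?thesis unfolding automatic_seq_def using assms(1) finite_subset by blast
qed

lemma automatic_kernel_self: "a \<in> automatic_kernel k a"
  unfolding automatic_kernel_def by (auto intro!: exI[of _ 0])

lemma automatic_kernel_section: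
  assumes "s \<in> automatic_kernel k a" "r < k"
  shows "(\<lambda>n. s (k * n + r)) \<in> automatic_kernel k a"
proof -
  obtain e q where s: "s = (\<lambda>n. a (k ^ e * n + q))" "q < k ^ e"
    using assms(1) by (auto simp: automatic_kernel_def)
  have "(\<lambda>n. s (k * n + r)) = (\<lambda>n. a (k ^ Suc e * n + (k ^ e * r + q)))"
    unfolding s(1) by (simp add: algebra_simps)
  moreover have "k ^ e * r + q < k ^ Suc e"
  proof -
    have "k ^ e * r + q < k ^ e * Suc r" using s(2) by simp
    also have "\<dots> \<le> k ^ e * k" by (rule mult_le_mono2) (use assms(2) in simp)
    finally show ?thesis by (simp add: mult.commute)
  qed
  ultimately show ?thesis unfolding automatic_kernel_def by blast
qed

text \<open>As \<open>n < k ^ n\<close>, the value \<open>a n\<close> is the initial term of a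
  kernel element, namely the one with exponent and offset both \<open>n\<close>.\<close>

lemma automatic_seq_finite_range:
  assumes "automatic_seq k a" "k \<ge> 2" shows "finite (range a)"
proof -
  have "a n \<in> (\<lambda>s. s 0) ` automatic_kernel k a" for n
  proof -
    have "n < 2 ^ n" by simp
    also have "\<dots> \<le> k ^ n" using assms(2) by (rule power_mono) simp
    finally have "(\<lambda>m. a (k ^ n * m + n)) \<in> automatic_kernel k a"
      unfolding automatic_kernel_def by blast
    then show ?thesis by (rule rev_image_eqI) simp
  qed
  then have "range a \<subseteq> (\<lambda>s. s 0) ` automatic_kernel k a" by blast
  then show ?thesis using assms(1) unfolding automatic_seq_def by (rule finite_subset[OF _ finite_imageI])
qed

lemma automatic_seq_map2:
  assumes "automatic_seq k a" "automatic_seq k b"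
  shows "automatic_seq k (\<lambda>n. h (a n) (b n))"
proof -
  let ?S = "(\<lambda>(s, t) n. h (s n) (t n)) ` (automatic_kernel k a \<times> automatic_kernel k b)"
  show ?thesis
  proof (rule automatic_seqI)
    show "finite ?S" using assms by (auto simp: automatic_seq_def)
    show "(\<lambda>n. h (a n) (b n)) \<in> ?S"
      by (rule image_eqI[of _ _ "(a, b)"]) (auto simp: automatic_kernel_self)
    fix s r assume "s \<in> ?S" "r < k"
    then obtain t u where h: "s = (\<lambda>n. h (t n) (u n))" "t \<in> automatic_kernel k a" "u \<in> automatic_kernel k b"
      by auto
    then show "(\<lambda>n. s (k * n + r)) \<in> ?S"
      using automatic_kernel_section[OF h(2) \<open>r < k\<close>] automatic_kernel_section[OF h(3) \<open>r < k\<close>]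
      by (intro image_eqI[of _ _ "(\<lambda>n. t (k * n + r), \<lambda>n. u (k * n + r))"]) auto
  qed
qed

lemma automatic_seq_map:
  assumes "automatic_seq k a" shows "automatic_seq k (\<lambda>n. h (a n))"
  using automatic_seq_map2[OF assms assms, of "\<lambda>x _. h x"] .

lemma automatic_seq_section:
  assumes "automatic_seq k a" "r < k" shows "automatic_seq k (\<lambda>n. a (k * n + r))"
proof (rule automatic_seqI[of "automatic_kernel k a"])
  show "finite (automatic_kernel k a)" using assms by (simp add: automatic_seq_def)
qed (auto intro: automatic_kernel_section automatic_kernel_self assms)

text \<open>A section of a shifted kernel element is an unshifted section at \<open>Suc r\<close>,
  except for the last digit, where a carry makes it the shift of the section at 0. So the kernel
  together with its shifts is closed.\<close>

lemma automatic_seq_Suc: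
  assumes "automatic_seq k a"
  shows "automatic_seq k (\<lambda>n. a (Suc n))"
proof -
  let ?A = "automatic_kernel k a"
  show ?thesis
  proof (rule automatic_seqI[of "?A \<union> (\<lambda>s n. s (Suc n)) ` ?A"])
    show "finite (?A \<union> (\<lambda>s n. s (Suc n)) ` ?A)" using assms by (simp add: automatic_seq_def)
    show "(\<lambda>n. a (Suc n)) \<in> ?A \<union> (\<lambda>s n. s (Suc n)) ` ?A" using automatic_kernel_self by blast
    fix s r assume h: "s \<in> ?A \<union> (\<lambda>s n. s (Suc n)) ` ?A" "r < k"
    show "(\<lambda>n. s (k * n + r)) \<in> ?A \<union> (\<lambda>s n. s (Suc n)) ` ?A"
    proof (cases "s \<in> ?A")
      case True
      then show ?thesis using automatic_kernel_section h(2) by blast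
    next
      case False
      then obtain t where t: "t \<in> ?A" "s = (\<lambda>n. t (Suc n))" using h(1) by blast
      show ?thesis
      proof (cases "Suc r < k")
        case True
        from automatic_kernel_section[OF t(1) this] show ?thesis by (simp add: t(2))
      next
        case False
        then have r: "k = Suc r" using h(2) by simp
        then have "(\<lambda>n. t (k * n + 0)) \<in> ?A" by (intro automatic_kernel_section t) simp
        moreover have "(\<lambda>n. s (k * n + r)) = (\<lambda>n. (\<lambda>n. t (k * n + 0)) (Suc n))"
          unfolding t(2) r by (simp add: algebra_simps)
        ultimately show ?thesis by (intro UnI2 image_eqI)
      qed
    qed
  qed
qed

text \<open>Prepending a value to a kernel element is undone by every section at a nonzero digit,
  while the section at 0 prepends the same value to the section at \<open>k - 1\<close>.\<close>

lemma automatic_seq_Suc_imp: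
  fixes a :: "nat \<Rightarrow> 'b"
  assumes "automatic_seq k (\<lambda>n. a (Suc n))" "k \<ge> 2"
  shows "automatic_seq k a"
proof -
  let ?A = "automatic_kernel k (\<lambda>n. a (Suc n))"
  have fin: "finite (range a)"
  proof -
    have "range a = insert (a 0) (range (\<lambda>n. a (Suc n)))"
      by (auto simp: image_iff) (metis not0_implies_Suc)
    then show ?thesis using automatic_seq_finite_range[OF assms] by simp
  qed
  define F where "F = (\<lambda>(c :: 'b, s) n. case n of 0 \<Rightarrow> c | Suc n \<Rightarrow> s n)"
  have F: "F (c, s) 0 = c" "F (c, s) (Suc n) = s n" for c s n by (simp_all add: F_def)
  let ?S = "?A \<union> F ` (range a \<times> ?A)"
  show ?thesis
  proof (rule automatic_seqI[of ?S])
    show "finite ?S" using assms fin by (simp add: automatic_seq_def)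
    have "(a 0, \<lambda>n. a (Suc n)) \<in> range a \<times> ?A" by (intro SigmaI rangeI automatic_kernel_self)
    moreover have "a = F (a 0, \<lambda>n. a (Suc n))"
    proof
      fix n show "a n = F (a 0, \<lambda>n. a (Suc n)) n" by (cases n) (simp_all add: F)
    qed
    ultimately show "a \<in> ?S" by (rule UnI2[OF rev_image_eqI])
    fix s r assume h: "s \<in> ?S" "r < k"
    show "(\<lambda>n. s (k * n + r)) \<in> ?S"
    proof (cases "s \<in> ?A")
      case True
      then show ?thesis using automatic_kernel_section h(2) by blast
    next
      case False
      then have "s \<in> F ` (range a \<times> ?A)" using h(1) by simp
      then obtain c t where t: "t \<in> ?A" "c \<in> range a" "s = F (c, t)" by auto
      show ?thesis
      proof (cases r)
        case (Suc q)
        then have "(\<lambda>n. t (k * n + q)) \<in> ?A" using h(2) by (intro automatic_kernel_section t) simp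
        then show ?thesis by (simp add: t(3) Suc F)
      next
        case 0
        obtain q where q: "k = Suc q" using h(2) by (cases k) auto
        have "(\<lambda>n. t (k * n + q)) \<in> ?A" by (intro automatic_kernel_section t) (simp add: q)
        with t(2) have "(c, \<lambda>n. t (k * n + q)) \<in> range a \<times> ?A" by (rule SigmaI)
        moreover have "(\<lambda>n. s (k * n + r)) = F (c, \<lambda>n. t (k * n + q))"
        proof
          fix n
          have "k * Suc m = Suc (k * m + q)" for m by (simp add: q)
          then show "s (k * n + r) = F (c, \<lambda>n. t (k * n + q)) n"
            unfolding 0 t(3) by (cases n) (simp_all add: F del: mult_Suc_right)
        qed
        ultimately show ?thesis by (rule UnI2[OF rev_image_eqI])
      qed
    qed
  qed
qed

lemma automatic_seq_const: "automatic_seq k (\<lambda>_. c)"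
  by (rule automatic_seqI[of "{\<lambda>_. c}"]) auto

lemma automatic_seq_dilate:
  assumes "automatic_seq k a" "k > 0"
  shows "automatic_seq k (\<lambda>n. if k dvd n then a (n div k) else c)"
proof -
  let ?A = "automatic_kernel k a"
  let ?d = "\<lambda>n. if k dvd n then a (n div k) else c"
  show ?thesis
  proof (rule automatic_seqI[of "{?d, \<lambda>_. c} \<union> ?A"])
    show "finite ({?d, \<lambda>_. c} \<union> ?A)" using assms by (simp add: automatic_seq_def)
    show "?d \<in> {?d, \<lambda>_. c} \<union> ?A" by simp
    fix s r assume h: "s \<in> {?d, \<lambda>_. c} \<union> ?A" "r < k"
    consider "s = ?d" | "s = (\<lambda>_. c)" | "s \<in> ?A" using h(1) by blast
    then show "(\<lambda>n. s (k * n + r)) \<in> {?d, \<lambda>_. c} \<union> ?A"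
    proof cases
      case 1
      show ?thesis
      proof (cases "r = 0")
        case True
        then have "(\<lambda>n. s (k * n + r)) = a" using assms(2) unfolding 1 by simp
        moreover have "a \<in> ?A" by (rule automatic_kernel_self)
        ultimately show ?thesis by simp
      next
        case False
        then have "\<not> k dvd (k * n + r)" for n using h(2) by (auto simp: dvd_add_right_iff dest: dvd_imp_le)
        then show ?thesis unfolding 1 by simp
      qed
    qed (use automatic_kernel_section[OF _ h(2)] in auto)
  qed
qed

lemma automatic_seq_add_index: "automatic_seq k a \<Longrightarrow> automatic_seq k (\<lambda>n. a (n + m))"
proof (induction m)
  case (Suc m)
  from automatic_seq_Suc[OF Suc.IH[OF Suc.prems]] show ?case by simp
qed simp

lemma automatic_seq_add_index_imp:
  "automatic_seq k (\<lambda>n. a (n + m)) \<Longrightarrow> k \<ge> 2 \<Longrightarrow> automatic_seq k a"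
proof (induction m)
  case (Suc m)
  have "automatic_seq k (\<lambda>n. a (n + m))"
    using Suc.prems by (intro automatic_seq_Suc_imp[of k "\<lambda>n. a (n + m)"]) simp_all
  then show ?case using Suc by blast
qed simp

section \<open>Automatic power series, dilation and sections\<close>

abbreviation automatic_fps :: "nat \<Rightarrow> 'a::zero fps \<Rightarrow> bool" where
  "automatic_fps k f \<equiv> automatic_seq k (fps_nth f)"

text \<open>The Mahler operator, substitution of \<open>X^k\<close> for \<open>X\<close>. Most facts
  assume \<open>k > 0\<close>, since \<open>fps_X ^ 0\<close> has a constant term.\<close>

definition fps_dilate :: "nat \<Rightarrow> 'a::comm_ring_1 fps \<Rightarrow> 'a fps" where
  "fps_dilate k f = f oo fps_X ^ k"

text \<open>The Cartier operators: on coefficients they are the one-digit sections that generate the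
  kernel.\<close>

definition fps_section :: "nat \<Rightarrow> nat \<Rightarrow> 'a::zero fps \<Rightarrow> 'a fps" where
  "fps_section k r f = Abs_fps (\<lambda>n. f $ (k * n + r))"

lemma fps_section_nth [simp]: "fps_section k r f $ n = f $ (k * n + r)"
  by (simp add: fps_section_def)

lemma fps_dilate_nth:
  assumes "k > 0"
  shows "fps_dilate k f $ n = (if k dvd n then f $ (n div k) else 0)"
proof -
  have "fps_dilate k f $ n = (\<Sum>i=0..n. f $ i * (if n = i * k then 1 else 0))"
    by (simp add: fps_dilate_def fps_compose_nth fps_X_power_nth mult.commute flip: power_mult)
  also have "\<dots> = (\<Sum>i\<in>(if k dvd n then {n div k} else {}). f $ i)"
  proof (rule sum.mono_neutral_cong_right)
    show "(if k dvd n then {n div k} else {}) \<subseteq> {0..n}" by (auto simp: div_le_dividend)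
  qed (use assms in \<open>auto split: if_splits\<close>)
  finally show ?thesis by simp
qed

context
  fixes k :: nat
  assumes k: "k > 0"
begin

lemma fps_dilate_eqI: "(\<And>n. g $ (k * n) = f $ n) \<Longrightarrow> (\<And>n. \<not> k dvd n \<Longrightarrow> g $ n = 0) \<Longrightarrow> fps_dilate k f = g"
  using k by (auto simp: fps_eq_iff fps_dilate_nth elim!: dvdE)

lemma fps_dilate_add: "fps_dilate k (f + g) = fps_dilate k f + fps_dilate k g"
  and fps_dilate_diff: "fps_dilate k (f - g) = fps_dilate k f - fps_dilate k (g :: 'a::comm_ring_1 fps)"
  by (simp_all add: fps_dilate_def fps_compose_add_distrib fps_compose_sub_distrib)

lemma fps_dilate_mult: "fps_dilate k (f * g) = fps_dilate k f * fps_dilate k (g :: 'a::idom fps)"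
  unfolding fps_dilate_def using k by (intro fps_compose_mult_distrib) (simp add: fps_X_power_nth)

lemma fps_dilate_X_power: "fps_dilate k (fps_X ^ m) = fps_X ^ (k * m)"
  using k by (intro fps_dilate_eqI) (auto simp: fps_X_power_nth)

lemma fps_dilate_1: "fps_dilate k 1 = 1"
  by (simp add: fps_dilate_def)

lemma fps_dilate_inj: "inj (fps_dilate k :: 'a::comm_ring_1 fps \<Rightarrow> 'a fps)"
proof (rule injI)
  fix f g :: "'a fps" assume "fps_dilate k f = fps_dilate k g"
  then have "fps_dilate k f $ (k * n) = fps_dilate k g $ (k * n)" for n by simp
  then show "f = g" using k by (simp add: fps_dilate_nth fps_eq_iff)
qed

text \<open>The dilated factor has only exponents divisible by \<open>k\<close>, so an exponent
  congruent to \<open>r\<close> in the product takes its whole remainder from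
  \<open>P\<close>.\<close>

lemma fps_section_mult_dilate:
  assumes "r < k"
  shows "fps_section k r (P * fps_dilate k g) = fps_section k r P * g"
proof (rule fps_ext)
  fix n
  have "fps_section k r (P * fps_dilate k g) $ n =
      (\<Sum>i=0..k * n + r. P $ i * (if k dvd (k * n + r - i) then g $ ((k * n + r - i) div k) else 0))"
    using k by (simp add: fps_mult_nth fps_dilate_nth)
  also have "\<dots> = (\<Sum>i\<in>(\<lambda>j. k * j + r) ` {0..n}. P $ i * g $ ((k * n + r - i) div k))"
  proof (rule sum.mono_neutral_cong_right)
    show "\<forall>i\<in>{0..k * n + r} - (\<lambda>j. k * j + r) ` {0..n}.
       P $ i * (if k dvd k * n + r - i then g $ ((k * n + r - i) div k) else 0) = 0"
    proof
      fix i assume i: "i \<in> {0..k * n + r} - (\<lambda>j. k * j + r) ` {0..n}"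
      have "\<not> k dvd k * n + r - i"
      proof
        assume "k dvd k * n + r - i"
        then obtain m where "k * n + r - i = k * m" by (elim dvdE)
        moreover have "i \<le> k * n + r" using i by simp
        ultimately have e: "k * n + r = k * m + i" by linarith
        have "i = k * (n - m) + r"
        proof -
          have "m \<le> n"
          proof (rule ccontr)
            assume "\<not> m \<le> n"
            then have "k * (n + 1) \<le> k * m" by (intro mult_le_mono2) simp
            then show False using e assms by simp
          qed
          then have "k * n = k * (n - m) + k * m"
            by (metis distrib_left le_add_diff_inverse2)
          then show ?thesis using e by simp
        qed
        then show False using i by (auto intro!: image_eqI[of _ _ "n - m"])
      qed
      then show "P $ i * (if k dvd k * n + r - i then g $ ((k * n + r - i) div k) else 0) = 0" by simp
    qed
    fix i assume "i \<in> (\<lambda>j. k * j + r) ` {0..n}"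
    then obtain j where j: "i = k * j + r" "j \<in> {0..n}" by blast
    then have "k * n + r - i = k * (n - j)" using j by (simp add: diff_mult_distrib2)
    then show "P $ i * (if k dvd k * n + r - i then g $ ((k * n + r - i) div k) else 0) =
        P $ i * g $ ((k * n + r - i) div k)" by simp
  qed auto
  also have "\<dots> = (\<Sum>j=0..n. P $ (k * j + r) * g $ ((k * n + r - (k * j + r)) div k))"
    using k by (subst sum.reindex) (auto simp: inj_on_def)
  also have "\<dots> = (\<Sum>j=0..n. P $ (k * j + r) * g $ (n - j))"
  proof (rule sum.cong[OF refl])
    fix j assume "j \<in> {0..n}"
    have "k * n + r - (k * j + r) = k * (n - j)" by (simp add: diff_mult_distrib2)
    then show "P $ (k * j + r) * g $ ((k * n + r - (k * j + r)) div k) = P $ (k * j + r) * g $ (n - j)"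
      using k by simp
  qed
  finally show "fps_section k r (P * fps_dilate k g) $ n = (fps_section k r P * g) $ n"
    by (simp add: fps_mult_nth)
qed

lemma fps_section_decompose:
  "f = (\<Sum>r<k. fps_X ^ r * fps_dilate k (fps_section k r f))"
proof (rule fps_ext)
  fix n
  have "(\<Sum>r<k. fps_X ^ r * fps_dilate k (fps_section k r f)) $ n =
     (\<Sum>r<k. if r \<le> n \<and> k dvd (n - r) then f $ (k * ((n - r) div k) + r) else 0)"
    unfolding fps_sum_nth using k by (intro sum.cong refl) (auto simp: fps_X_power_mult_nth fps_dilate_nth)
  also have "\<dots> = (\<Sum>r<k. if r = n mod k then f $ n else 0)"
  proof (rule sum.cong[OF refl])
    fix r assume "r \<in> {..<k}"
    then have r: "r < k" by simp
    have "r \<le> n \<and> k dvd (n - r) \<longleftrightarrow> r = n mod k"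
    proof
      assume "r \<le> n \<and> k dvd (n - r)"
      then have "n mod k = r mod k" by (metis mod_eq_dvd_iff_nat)
      then show "r = n mod k" using r by simp
    next
      assume "r = n mod k"
      then show "r \<le> n \<and> k dvd (n - r)" by (simp add: minus_mod_eq_mult_div)
    qed
    then show "(if r \<le> n \<and> k dvd (n - r) then f $ (k * ((n - r) div k) + r) else 0)
        = (if r = n mod k then f $ n else 0)" by auto
  qed
  also have "\<dots> = f $ n" using k by simp
  finally show "f $ n = (\<Sum>r<k. fps_X ^ r * fps_dilate k (fps_section k r f)) $ n" by simp
qed

end

lemma fps_dilate_dilate: "j > 0 \<Longrightarrow> k > 0 \<Longrightarrow> fps_dilate j (fps_dilate k f) = fps_dilate (j * k) f"
proof (rule fps_ext)
  fix n assume pos: "j > 0" "k > 0"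
  show "fps_dilate j (fps_dilate k f) $ n = fps_dilate (j * k) f $ n"
  proof (cases "j dvd n")
    case True
    then obtain m where "n = j * m" by (elim dvdE)
    then show ?thesis using pos by (simp add: fps_dilate_nth)
  next
    case False
    then have "\<not> j * k dvd n" using dvd_mult_left by blast
    then show ?thesis using pos False by (simp add: fps_dilate_nth)
  qed
qed

lemma fps_dilate_one: "fps_dilate 1 f = f"
  by (rule fps_dilate_eqI) auto

lemma fps_dilate_iterate: "fps_dilate k (fps_dilate (k ^ i) f) = fps_dilate (k ^ Suc i) f" if "k > 0"
  using that by (simp add: fps_dilate_dilate)

lemma automatic_fps_add:
  "automatic_fps k f \<Longrightarrow> automatic_fps k g \<Longrightarrow> automatic_fps k (f + g)"
  using automatic_seq_map2[of k "fps_nth f" "fps_nth g" "(+)"]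
  by (simp add: fps_add_nth[abs_def])

lemma automatic_fps_const_mult:
  fixes f :: "'a::comm_ring_1 fps"
  shows "automatic_fps k f \<Longrightarrow> automatic_fps k (fps_const c * f)"
proof -
  assume "automatic_fps k f"
  moreover have "fps_nth (fps_const c * f) = (\<lambda>n. c * f $ n)" by (simp add: fun_eq_iff)
  ultimately show ?thesis using automatic_seq_map by metis
qed

lemma automatic_fps_0: "automatic_fps k 0"
  using automatic_seq_const[of k 0] by (simp add: fps_zero_nth[abs_def])

lemma automatic_fps_sum:
  "(\<And>i. i \<in> A \<Longrightarrow> automatic_fps k (f i)) \<Longrightarrow> automatic_fps k (sum f A)"
  by (induction A rule: infinite_finite_induct) (auto simp: automatic_fps_0 automatic_fps_add)

lemma automatic_fps_X_power_mult:
  assumes "automatic_fps k f" "k \<ge> 2" shows "automatic_fps k (fps_X ^ m * f)"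
  by (rule automatic_seq_add_index_imp[of k _ m]) (use assms in \<open>simp_all add: fps_X_power_mult_nth\<close>)

lemma automatic_fps_dilate:
  assumes "automatic_fps k f" "k > 0" shows "automatic_fps k (fps_dilate k f)"
proof -
  have "fps_nth (fps_dilate k f) = (\<lambda>n. if k dvd n then f $ (n div k) else 0)"
    using assms(2) by (simp add: fun_eq_iff fps_dilate_nth)
  then show ?thesis using automatic_seq_dilate[OF assms, of 0] by simp
qed

lemma automatic_fps_dilate_power:
  assumes "automatic_fps k f" "k > 0" shows "automatic_fps k (fps_dilate (k ^ i) f)"
proof (induction i)
  case 0
  then show ?case using assms fps_dilate_one[of f] by simp
next
  case (Suc i)
  from automatic_fps_dilate[OF this assms(2)] show ?case
    using fps_dilate_iterate[OF assms(2), of i f] by simp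
qed

lemma fps_eq_sum_monomials:
  fixes c :: "'a::comm_ring_1 fps"
  assumes "\<And>n. n > D \<Longrightarrow> c $ n = 0"
  shows "c = (\<Sum>n\<le>D. fps_const (c $ n) * fps_X ^ n)"
  using assms by (intro fps_ext) (auto simp: fps_sum_nth fps_X_power_nth not_le if_distrib cong: if_cong)

text \<open>A polynomial, encoded as a power series vanishing beyond some \<open>D\<close>, acts by
  a finite combination of shifts.\<close>

lemma automatic_fps_poly_mult:
  fixes c :: "'a::comm_ring_1 fps"
  assumes "automatic_fps k f" "k \<ge> 2" "\<And>n. n > D \<Longrightarrow> c $ n = 0"
  shows "automatic_fps k (c * f)"
proof -
  have "c * f = (\<Sum>n\<le>D. fps_const (c $ n) * fps_X ^ n) * f"
    using fps_eq_sum_monomials[OF assms(3)] by simp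
  also have "\<dots> = (\<Sum>n\<le>D. fps_const (c $ n) * (fps_X ^ n * f))"
    by (simp add: sum_distrib_right mult.assoc)
  finally show ?thesis
    using assms by (auto intro!: automatic_fps_sum automatic_fps_const_mult automatic_fps_X_power_mult)
qed

lemma automatic_fps_1: "k \<ge> 2 \<Longrightarrow> automatic_fps k 1"
  by (rule automatic_seq_Suc_imp) (auto simp: automatic_seq_const)

lemma automatic_fps_poly:
  assumes "k \<ge> 2" "\<And>n. n > D \<Longrightarrow> c $ n = 0"
  shows "automatic_fps k (c :: 'a::comm_ring_1 fps)"
  using automatic_fps_poly_mult[OF automatic_fps_1[OF assms(1)] assms] by simp

lemma automatic_fps_section: "automatic_fps k f \<Longrightarrow> r < k \<Longrightarrow> automatic_fps k (fps_section k r f)"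
  and automatic_fps_shift: "automatic_fps k f \<Longrightarrow> automatic_fps k (fps_shift m f)"
proof -
  have "fps_nth (fps_section k r f) = (\<lambda>n. f $ (k * n + r))" "fps_nth (fps_shift m f) = (\<lambda>n. f $ (n + m))"
    by (simp_all add: fun_eq_iff)
  then show "automatic_fps k f \<Longrightarrow> r < k \<Longrightarrow> automatic_fps k (fps_section k r f)"
    "automatic_fps k f \<Longrightarrow> automatic_fps k (fps_shift m f)"
    by (simp_all add: automatic_seq_section automatic_seq_add_index)
qed

subsection \<open>Power series modulo the place\<close>

context residue_place
begin

definition val_fps :: "'a fps \<Rightarrow> bool" where
  "val_fps f \<longleftrightarrow> (\<forall>n. f $ n \<in> val_ring)"

definition fps_cong :: "'a fps \<Rightarrow> 'a fps \<Rightarrow> bool" (infix "\<approx>" 50) where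
  "f \<approx> g \<longleftrightarrow> (\<forall>n. f $ n - g $ n \<in> I)"

text \<open>Polynomials are kept as power series, so that products, dilations and sections need no
  conversion.\<close>

definition poly_over :: "'a set \<Rightarrow> 'a fps \<Rightarrow> bool" where
  "poly_over B f \<longleftrightarrow> (\<forall>n. f $ n \<in> B) \<and> (\<exists>D. \<forall>n>D. f $ n = 0)"

lemma fps_cong_refl: "f \<approx> f"
  by (simp add: fps_cong_def I_0)

lemma fps_cong_sym: "f \<approx> g \<Longrightarrow> g \<approx> f"
  unfolding fps_cong_def using I_minus by (metis minus_diff_eq)

lemma fps_cong_trans [trans]: "f \<approx> g \<Longrightarrow> g \<approx> h \<Longrightarrow> f \<approx> h"
  unfolding fps_cong_def
proof
  fix n assume "\<forall>n. f $ n - g $ n \<in> I" "\<forall>n. g $ n - h $ n \<in> I"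
  then have "(f $ n - g $ n) + (g $ n - h $ n) \<in> I" by (intro I_add) auto
  then show "f $ n - h $ n \<in> I" by simp
qed

lemma fps_cong_add: "f \<approx> g \<Longrightarrow> f' \<approx> g' \<Longrightarrow> f + f' \<approx> g + g'"
  unfolding fps_cong_def
proof
  fix n assume "\<forall>n. f $ n - g $ n \<in> I" "\<forall>n. f' $ n - g' $ n \<in> I"
  then have "(f $ n - g $ n) + (f' $ n - g' $ n) \<in> I" by (intro I_add) auto
  then show "(f + f') $ n - (g + g') $ n \<in> I" by (simp add: algebra_simps)
qed

lemma fps_cong_diff: "f \<approx> g \<Longrightarrow> f' \<approx> g' \<Longrightarrow> f - f' \<approx> g - g'"
  unfolding fps_cong_def
proof
  fix n assume "\<forall>n. f $ n - g $ n \<in> I" "\<forall>n. f' $ n - g' $ n \<in> I"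
  then have "(f $ n - g $ n) - (f' $ n - g' $ n) \<in> I" by (blast intro: I_diff)
  then show "(f - f') $ n - (g - g') $ n \<in> I" by (simp add: algebra_simps)
qed

lemma fps_cong_sum: "(\<And>i. i \<in> A \<Longrightarrow> f i \<approx> g i) \<Longrightarrow> sum f A \<approx> sum g A"
  by (induction A rule: infinite_finite_induct) (auto intro: fps_cong_refl fps_cong_add)

lemma fps_cong_mult_left:
  assumes "f \<approx> g" "val_fps h" shows "h * f \<approx> h * g"
  unfolding fps_cong_def
proof
  fix n
  have "(h * f) $ n - (h * g) $ n = (\<Sum>i=0..n. h $ i * (f $ (n - i) - g $ (n - i)))"
    by (simp add: fps_mult_nth sum_subtractf right_diff_distrib)
  also have "\<dots> \<in> I" using assms by (intro I_sum val_ring_I_mult) (auto simp: fps_cong_def val_fps_def)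
  finally show "(h * f) $ n - (h * g) $ n \<in> I" .
qed

lemma fps_cong_section: "f \<approx> g \<Longrightarrow> fps_section k r f \<approx> fps_section k r g"
  by (simp add: fps_cong_def)

lemma fps_cong_shift: "f \<approx> g \<Longrightarrow> fps_shift m f \<approx> fps_shift m g"
  by (simp add: fps_cong_def)

lemma val_fps_mult: "val_fps f \<Longrightarrow> val_fps g \<Longrightarrow> val_fps (f * g)"
  unfolding val_fps_def fps_mult_nth by (auto intro: val_ring_sum val_ring_mult)

lemma val_fps_add: "val_fps f \<Longrightarrow> val_fps g \<Longrightarrow> val_fps (f + g)"
  and val_fps_diff: "val_fps f \<Longrightarrow> val_fps g \<Longrightarrow> val_fps (f - g)"
  unfolding val_fps_def by (auto intro: val_ring_add val_ring_diff)

lemma val_fps_sum: "(\<And>i. i \<in> A \<Longrightarrow> val_fps (f i)) \<Longrightarrow> val_fps (sum f A)"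
  unfolding val_fps_def fps_sum_nth by (auto intro: val_ring_sum)

lemma val_fps_dilate: "val_fps f \<Longrightarrow> k > 0 \<Longrightarrow> val_fps (fps_dilate k f)"
  unfolding val_fps_def by (auto simp: fps_dilate_nth val_ring_0)

lemma val_fps_X_power: "val_fps (fps_X ^ m)"
  unfolding val_fps_def by (auto simp: fps_X_power_nth val_ring_0 one_in_val_ring)

lemma val_fps_section: "val_fps f \<Longrightarrow> val_fps (fps_section k r f)"
  and val_fps_shift: "val_fps f \<Longrightarrow> val_fps (fps_shift m f)"
  unfolding val_fps_def by auto

lemma poly_over_val_fps: "poly_over B f \<Longrightarrow> B \<subseteq> val_ring \<Longrightarrow> val_fps f"
  unfolding poly_over_def val_fps_def by auto

section \<open>Polynomials over a ring with finite residues, and the modules they span modulo the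
  place\<close>

context
  fixes B :: "'a set"
  assumes B: "res_finite_ring B"
begin

lemma B_closed: "closed_diff_mult B" and B_1: "1 \<in> B" and B_val: "B \<subseteq> val_ring"
  and B_fin: "finite (residue ` B)"
  using B by (auto simp: res_finite_ring_def)

lemmas B_0 = closed_diff_mult_0[OF B_closed]

lemma poly_over_0: "poly_over B 0"
  by (simp add: poly_over_def B_0)

lemma poly_over_X_power: "poly_over B (fps_X ^ m)"
  unfolding poly_over_def using B_0 B_1 by (auto simp: fps_X_power_nth intro!: exI[of _ m])

lemma poly_over_const: "c \<in> B \<Longrightarrow> poly_over B (fps_const c)"
  unfolding poly_over_def using B_0 by (auto intro!: exI[of _ 0])

lemma poly_over_diff: "poly_over B f \<Longrightarrow> poly_over B g \<Longrightarrow> poly_over B (f - g)"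
proof -
  assume "poly_over B f" "poly_over B g"
  then obtain D E where "\<forall>n. f $ n \<in> B" "\<forall>n. g $ n \<in> B" "\<forall>n>D. f $ n = 0" "\<forall>n>E. g $ n = 0"
    by (auto simp: poly_over_def)
  then show ?thesis unfolding poly_over_def
    by (auto intro!: closed_diff_mult_diff[OF B_closed] exI[of _ "max D E"])
qed

lemma poly_over_add: "poly_over B f \<Longrightarrow> poly_over B g \<Longrightarrow> poly_over B (f + g)"
  using poly_over_diff[of f "0 - g"] poly_over_diff[of 0 g] poly_over_0 by simp

lemma poly_over_sum: "(\<And>i. i \<in> A \<Longrightarrow> poly_over B (f i)) \<Longrightarrow> poly_over B (sum f A)"
  by (induction A rule: infinite_finite_induct) (auto simp: poly_over_0 poly_over_add)

lemma fps_mult_vanishes: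
  assumes "\<forall>n>D. f $ n = 0" "\<forall>n>E. g $ n = (0::'a)" "n > D + E"
  shows "(f * g) $ n = 0"
  unfolding fps_mult_nth
proof (rule sum.neutral, rule ballI)
  fix i
  have "i > D \<or> n - i > E" using assms(3) by linarith
  then show "f $ i * g $ (n - i) = 0" using assms by auto
qed

lemma poly_over_mult: "poly_over B f \<Longrightarrow> poly_over B g \<Longrightarrow> poly_over B (f * g)"
proof -
  assume "poly_over B f" "poly_over B g"
  then obtain D E where h: "\<forall>n. f $ n \<in> B" "\<forall>n. g $ n \<in> B" "\<forall>n>D. f $ n = 0" "\<forall>n>E. g $ n = 0"
    by (auto simp: poly_over_def)
  have "(f * g) $ n \<in> B" for n
    unfolding fps_mult_nth using h by (intro closed_diff_mult_sum[OF B_closed] closed_diff_mult_mult[OF B_closed]) auto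
  then show ?thesis unfolding poly_over_def using fps_mult_vanishes[OF h(3,4)] by blast
qed

lemma poly_over_power: "poly_over B f \<Longrightarrow> poly_over B (f ^ m)"
  using poly_over_X_power[of 0] by (induction m) (auto intro: poly_over_mult)

lemma finite_common_degree:
  assumes "finite S" "\<And>c. c \<in> S \<Longrightarrow> poly_over B c"
  shows "\<exists>D. \<forall>c\<in>S. \<forall>n>D. c $ n = 0"
proof -
  have "\<forall>c\<in>S. \<exists>D. \<forall>n>D. c $ n = 0" using assms(2) by (auto simp: poly_over_def)
  then obtain d where d: "\<forall>c\<in>S. \<forall>n>d c. c $ n = 0" by metis
  have "d c \<le> Max (d ` S)" if "c \<in> S" for c using that assms(1) by simp
  then show ?thesis using d by (meson le_less_trans)
qed

text \<open>For finite \<open>X\<close> this is the module generated by \<open>X\<close> over the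
  polynomials with coefficients in \<open>B\<close>, saturated under congruence.\<close>

definition span_mod :: "'a fps set \<Rightarrow> 'a fps set" where
  "span_mod X = {f. \<exists>C. (\<forall>x\<in>X. poly_over B (C x)) \<and> f \<approx> (\<Sum>x\<in>X. C x * x)}"

lemma span_modI: "(\<And>x. x \<in> X \<Longrightarrow> poly_over B (C x)) \<Longrightarrow> f \<approx> (\<Sum>x\<in>X. C x * x) \<Longrightarrow> f \<in> span_mod X"
  unfolding span_mod_def by blast

lemma span_mod_0: "0 \<in> span_mod X"
  unfolding span_mod_def using poly_over_0 by (auto intro!: exI[of _ "\<lambda>_. 0"] fps_cong_refl)

lemma span_mod_cong: "f \<in> span_mod X \<Longrightarrow> g \<approx> f \<Longrightarrow> g \<in> span_mod X"
  unfolding span_mod_def using fps_cong_trans by blast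

lemma span_mod_add:
  assumes "f \<in> span_mod X" "g \<in> span_mod X" shows "f + g \<in> span_mod X"
proof -
  obtain C E where h: "\<forall>x\<in>X. poly_over B (C x)" "f \<approx> (\<Sum>x\<in>X. C x * x)"
    "\<forall>x\<in>X. poly_over B (E x)" "g \<approx> (\<Sum>x\<in>X. E x * x)"
    using assms unfolding span_mod_def by blast
  have "f + g \<approx> (\<Sum>x\<in>X. (C x + E x) * x)" using fps_cong_add[OF h(2,4)] by (simp add: sum.distrib distrib_right)
  then show ?thesis using h by (intro span_modI[where C = "\<lambda>x. C x + E x"]) (auto intro: poly_over_add)
qed

lemma span_mod_sum: "(\<And>i. i \<in> A \<Longrightarrow> f i \<in> span_mod X) \<Longrightarrow> sum f A \<in> span_mod X"
  by (induction A rule: infinite_finite_induct) (auto simp: span_mod_0 span_mod_add)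

lemma span_mod_mult:
  assumes "f \<in> span_mod X" "poly_over B c" shows "c * f \<in> span_mod X"
proof -
  obtain C where h: "\<forall>x\<in>X. poly_over B (C x)" "f \<approx> (\<Sum>x\<in>X. C x * x)"
    using assms(1) unfolding span_mod_def by blast
  have "c * f \<approx> c * (\<Sum>x\<in>X. C x * x)"
    by (intro fps_cong_mult_left h poly_over_val_fps[OF assms(2) B_val])
  also have "\<dots> = (\<Sum>x\<in>X. (c * C x) * x)" by (simp add: sum_distrib_left mult.assoc)
  finally show ?thesis
    by (rule span_modI[rotated]) (use h(1) poly_over_mult[OF assms(2)] in blast)
qed

lemma span_mod_base:
  assumes "x \<in> X" "finite X" shows "x \<in> span_mod X"
proof -
  let ?C = "\<lambda>y. if y = x then fps_X ^ 0 else 0 :: 'a fps"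
  have "(\<Sum>y\<in>X. ?C y * y) = (\<Sum>y\<in>X. if y = x then y else 0)"
    by (rule sum.cong) auto
  also have "\<dots> = x" using assms by simp
  finally have "x \<approx> (\<Sum>y\<in>X. ?C y * y)" using fps_cong_refl[of x] by simp
  then show ?thesis using poly_over_X_power[of 0] poly_over_0
    by (intro span_modI[where C = ?C]) auto
qed

text \<open>If the generators are combinations of their own dilations, a section of a combination of
  generators is again one: substitute, then pull the dilated generators out of the section. Products
  of two coefficients of degree at most \<open>D\<close> have degree at most \<open>2 * D\<close>,
  and a section divides this by \<open>k\<close>, so the degree bound \<open>D\<close> persists.
  Only finitely many coefficient families exist up to congruence, and they contain the
  kernel.\<close>

lemma automatic_residue_of_span:
  assumes k: "k \<ge> 2" and X: "finite X" "\<And>x. x \<in> X \<Longrightarrow> val_fps x"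
    "\<And>x. x \<in> X \<Longrightarrow> x \<in> span_mod (fps_dilate k ` X)"
    and f: "f \<in> span_mod X"
  shows "automatic_seq k (\<lambda>n. residue (f $ n))"
proof -
  have k0: "k > 0" using k by simp
  have "\<forall>x\<in>X. \<exists>P. (\<forall>y\<in>X. poly_over B (P y)) \<and> x \<approx> (\<Sum>y\<in>X. P y * fps_dilate k y)"
  proof
    fix x assume "x \<in> X"
    from X(3)[OF this] obtain C where C: "\<forall>y\<in>fps_dilate k ` X. poly_over B (C y)"
      "x \<approx> (\<Sum>y\<in>fps_dilate k ` X. C y * y)" unfolding span_mod_def by blast
    have "(\<Sum>y\<in>fps_dilate k ` X. C y * y) = (\<Sum>y\<in>X. C (fps_dilate k y) * fps_dilate k y)"
      by (subst sum.reindex) (auto intro: inj_on_subset[OF fps_dilate_inj[OF k0]])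
    then show "\<exists>P. (\<forall>y\<in>X. poly_over B (P y)) \<and> x \<approx> (\<Sum>y\<in>X. P y * fps_dilate k y)"
      using C by (intro exI[of _ "\<lambda>y. C (fps_dilate k y)"]) auto
  qed
  then obtain P where P: "\<And>x y. x \<in> X \<Longrightarrow> y \<in> X \<Longrightarrow> poly_over B (P x y)"
    "\<And>x. x \<in> X \<Longrightarrow> x \<approx> (\<Sum>y\<in>X. P x y * fps_dilate k y)" by metis
  obtain C0 where C0: "\<And>x. x \<in> X \<Longrightarrow> poly_over B (C0 x)" "f \<approx> (\<Sum>x\<in>X. C0 x * x)"
    using f unfolding span_mod_def by blast
  \<comment> \<open>One bound \<open>D\<close> has to serve both the transition coefficients
    \<open>P\<close> and the initial coefficients \<open>C0\<close>.\<close>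
  have "\<exists>D. \<forall>c \<in> (\<lambda>(x, y). P x y) ` (X \<times> X) \<union> C0 ` X. \<forall>n>D. c $ n = 0"
    by (rule finite_common_degree) (use X(1) P(1) C0(1) in auto)
  then obtain D where "\<forall>c \<in> (\<lambda>(x, y). P x y) ` (X \<times> X) \<union> C0 ` X. \<forall>n>D. c $ n = 0" by blast
  then have D: "\<And>x y n. x \<in> X \<Longrightarrow> y \<in> X \<Longrightarrow> n > D \<Longrightarrow> P x y $ n = 0"
    "\<And>x n. x \<in> X \<Longrightarrow> n > D \<Longrightarrow> C0 x $ n = 0" by auto
  define R where "R C = (\<lambda>n. residue ((\<Sum>x\<in>X. C x * x) $ n))" for C
  let ?P = "{c. (\<forall>n. c $ n \<in> B) \<and> (\<forall>n>D. c $ n = 0)}"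
  have R_cong: "(\<lambda>n. residue (g $ n)) = R C" if "g \<approx> (\<Sum>x\<in>X. C x * x)" for g C
    using that by (simp add: R_def fun_eq_iff residue_eq_iff fps_cong_def)
  have val_P: "val_fps c" if "c \<in> ?P" for c using that B_val by (auto simp: val_fps_def)
  show ?thesis
  proof (rule automatic_seqI[of "R ` (X \<rightarrow> ?P)"])
    obtain T where T: "finite T" "T \<subseteq> B" "residue ` B = residue ` T"
      using B_fin by (metis finite_subset_image subset_refl)
    let ?T = "{c. (\<forall>n\<le>D. c $ n \<in> T) \<and> (\<forall>n>D. c $ n = 0)}"
    have fT: "finite ?T"
    proof (rule finite_subset)
      show "?T \<subseteq> (\<lambda>t. Abs_fps (\<lambda>n. if n \<le> D then t n else 0)) ` ({..D} \<rightarrow>\<^sub>E T)"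
      proof
        fix c assume c: "c \<in> ?T"
        then show "c \<in> (\<lambda>t. Abs_fps (\<lambda>n. if n \<le> D then t n else 0)) ` ({..D} \<rightarrow>\<^sub>E T)"
          by (intro image_eqI[of _ _ "restrict (fps_nth c) {..D}"]) (auto simp: fps_eq_iff)
      qed
      show "finite ((\<lambda>t. Abs_fps (\<lambda>n. if n \<le> D then t n else 0)) ` ({..D} \<rightarrow>\<^sub>E T))"
        by (intro finite_imageI finite_PiE T) auto
    qed
    \<comment> \<open>\<open>B\<close> may be infinite, but \<open>R\<close> sees coefficients only
      up to congruence, so those taken from the finite set \<open>T\<close> give all of its
      values.\<close>
    have "R ` (X \<rightarrow> ?P) \<subseteq> R ` (X \<rightarrow>\<^sub>E ?T)"
    proof
      fix s assume "s \<in> R ` (X \<rightarrow> ?P)"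
      then obtain C where C: "s = R C" "C \<in> X \<rightarrow> ?P" by blast
      have "\<exists>t. t \<in> ?T \<and> C x \<approx> t" if x: "x \<in> X" for x
      proof -
        have "\<exists>t\<in>T. residue (C x $ n) = residue t" for n
        proof -
          have "C x $ n \<in> B" using C(2) x by auto
          then have "residue (C x $ n) \<in> residue ` T" using T(3) by blast
          then show ?thesis by blast
        qed
        then obtain t where t: "\<And>n. t n \<in> T" "\<And>n. residue (C x $ n) = residue (t n)" by metis
        have "C x \<approx> Abs_fps (\<lambda>n. if n \<le> D then t n else 0)"
          unfolding fps_cong_def
        proof
          fix n
          have "C x $ n = 0" if "n > D" using C(2) x that by auto
          then show "C x $ n - Abs_fps (\<lambda>n. if n \<le> D then t n else 0) $ n \<in> I"
            using t(2)[of n] I_0 by (simp add: residue_eq_iff)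
        qed
        then show ?thesis using t(1) by (intro exI[of _ "Abs_fps (\<lambda>n. if n \<le> D then t n else 0)"]) auto
      qed
      then have "\<forall>x\<in>X. \<exists>t. t \<in> ?T \<and> C x \<approx> t" by simp
      from bchoice[OF this] obtain t where "\<forall>x\<in>X. t x \<in> ?T \<and> C x \<approx> t x" ..
      then have t: "\<And>x. x \<in> X \<Longrightarrow> t x \<in> ?T" "\<And>x. x \<in> X \<Longrightarrow> C x \<approx> t x" by simp_all
      have "(\<Sum>x\<in>X. C x * x) \<approx> (\<Sum>x\<in>X. t x * x)"
        using t(2) X(2) fps_cong_mult_left[of "C x" "t x" x for x]
        by (intro fps_cong_sum) (simp add: mult.commute)
      also have "(\<Sum>x\<in>X. t x * x) = (\<Sum>x\<in>X. restrict t X x * x)" by simp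
      finally have "R C = R (restrict t X)" by (subst R_def) (rule R_cong)
      then show "s \<in> R ` (X \<rightarrow>\<^sub>E ?T)" unfolding C(1)
        using t(1) by (intro image_eqI[of _ _ "restrict t X"]) (simp_all add: restrict_PiE_iff)
    qed
    then show "finite (R ` (X \<rightarrow> ?P))"
      by (rule finite_subset) (intro finite_imageI finite_PiE X fT)
    have "C0 \<in> X \<rightarrow> ?P" using C0(1) D(2) by (auto simp: poly_over_def)
    then show "(\<lambda>n. residue (f $ n)) \<in> R ` (X \<rightarrow> ?P)"
      by (rule rev_image_eqI) (rule R_cong[OF C0(2)])
    fix s r assume "s \<in> R ` (X \<rightarrow> ?P)" and r: "r < k"
    then obtain C where C: "s = R C" "\<And>x. x \<in> X \<Longrightarrow> C x \<in> ?P" by blast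
    define E where "E y = (\<Sum>x\<in>X. C x * P x y)" for y
    have "(\<Sum>x\<in>X. C x * x) \<approx> (\<Sum>x\<in>X. C x * (\<Sum>y\<in>X. P x y * fps_dilate k y))"
      by (intro fps_cong_sum fps_cong_mult_left P(2) val_P C(2))
    also have "\<dots> = (\<Sum>y\<in>X. E y * fps_dilate k y)"
      unfolding E_def sum_distrib_left sum_distrib_right by (subst sum.swap) (simp add: mult.assoc)
    finally have "fps_section k r (\<Sum>x\<in>X. C x * x) \<approx> fps_section k r (\<Sum>y\<in>X. E y * fps_dilate k y)"
      by (rule fps_cong_section)
    also have "fps_section k r (\<Sum>y\<in>X. E y * fps_dilate k y) = (\<Sum>y\<in>X. fps_section k r (E y * fps_dilate k y))"
      by (simp add: fps_eq_iff fps_sum_nth)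
    also have "\<dots> = (\<Sum>y\<in>X. fps_section k r (E y) * y)"
      by (intro sum.cong refl fps_section_mult_dilate k0 r)
    finally have "fps_section k r (\<Sum>x\<in>X. C x * x) \<approx> (\<Sum>y\<in>X. fps_section k r (E y) * y)" .
    from R_cong[OF this] have sE: "(\<lambda>n. s (k * n + r)) = R (\<lambda>y. fps_section k r (E y))"
      by (simp add: C(1) R_def)
    have "fps_section k r (E y) \<in> ?P" if y: "y \<in> X" for y
    proof -
      have "poly_over B (C x)" if "x \<in> X" for x using C(2)[OF that] by (auto simp: poly_over_def)
      then have "poly_over B (E y)" unfolding E_def using P(1) y by (intro poly_over_sum poly_over_mult) auto
      moreover have "E y $ (k * n + r) = 0" if "n > D" for n
      proof -
        \<comment> \<open>Here \<open>k >= 2\<close> brings the degree from \<open>2 * D\<close>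
          back to \<open>D\<close>.\<close>
        have "2 * n \<le> k * n" using k by (rule mult_le_mono1)
        then have n: "k * n + r > D + D" using that by linarith
        have "(C x * P x y) $ (k * n + r) = 0" if "x \<in> X" for x
          using C(2)[OF that] D(1)[OF that y] by (intro fps_mult_vanishes[OF _ _ n]) auto
        then show ?thesis by (simp add: E_def fps_sum_nth)
      qed
      ultimately show ?thesis by (auto simp: poly_over_def)
    qed
    then have "(\<lambda>y. fps_section k r (E y)) \<in> X \<rightarrow> ?P" by simp
    then show "(\<lambda>n. s (k * n + r)) \<in> R ` (X \<rightarrow> ?P)" 
      by (rule rev_image_eqI) (rule sE)
  qed
qed

end

text \<open>With \<open>y = X^(K' * M)\<close>, the identity
  \<open>1 - y^l = l * (1 - y) - (1 - y)^2 * v\<close> holds exactly; the first term vanishes modulo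
  the place and \<open>1 - y\<close> is a multiple \<open>(1 - X^M) * w\<close>. Thus the cofactor
  is \<open>- w^2 * v\<close>.\<close>

lemma one_diff_X_power_cong_square:
  assumes B: "res_finite_ring B" and K: "l dvd K"
  shows "\<exists>S. poly_over B S \<and> 1 - fps_X ^ (K * M) \<approx> (1 - fps_X ^ M) ^ 2 * S"
proof -
  obtain K' where K': "K = l * K'" using K by (elim dvdE)
  define y :: "'a fps" where "y = fps_X ^ (K' * M)"
  define w where "w = (\<Sum>i<K'. (fps_X ^ M) ^ i :: 'a fps)"
  define v where "v = (\<Sum>j<l. \<Sum>i<j. y ^ i)"
  have y: "1 - y = (1 - fps_X ^ M) * w"
    unfolding y_def w_def by (subst one_diff_power_eq[symmetric]) (simp add: mult.commute flip: power_mult)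
  have "1 - fps_X ^ (K * M) = 1 - y ^ l"
    by (simp add: y_def K' mult.commute mult.left_commute flip: power_mult)
  also have "\<dots> = (1 - y) * (\<Sum>j<l. y ^ j)" by (rule one_diff_power_eq)
  also have "(\<Sum>j<l. y ^ j) = (\<Sum>j<l. 1 - (1 - y) * (\<Sum>i<j. y ^ i))"
    by (simp flip: one_diff_power_eq)
  also have "\<dots> = of_nat l - (1 - y) * v" by (simp add: sum_subtractf sum_distrib_left v_def)
  finally have e: "1 - fps_X ^ (K * M) - (1 - fps_X ^ M) ^ 2 * (0 - w ^ 2 * v) = of_nat l * (1 - y)"
    by (simp add: y algebra_simps power2_eq_square)
  have "(of_nat l * (1 - y)) $ n \<in> I" for n
  proof -
    have "(of_nat l * (1 - y)) $ n = of_nat l * ((1 - y) $ n)"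
      by (simp flip: fps_of_nat)
    also have "\<dots> \<in> I" unfolding y_def
      by (intro I_val_ring_mult l_in_I) (auto simp: fps_X_power_nth fps_one_nth val_ring_0 one_in_val_ring val_ring_minus)
    finally show ?thesis .
  qed
  then have "1 - fps_X ^ (K * M) \<approx> (1 - fps_X ^ M) ^ 2 * (0 - w ^ 2 * v)"
    unfolding fps_cong_def e[symmetric] by simp
  moreover have "poly_over B (0 - w ^ 2 * v)"
    unfolding w_def v_def y_def
    by (intro poly_over_diff poly_over_mult poly_over_power poly_over_sum poly_over_X_power poly_over_0 B)
  ultimately show ?thesis by blast
qed

text \<open>Put \<open>f = N * h\<close>. The equation becomes one for \<open>N^2 * h\<close>: one
  factor \<open>N\<close> is the given coefficient, the other comes from the substitution. Every
  dilation of \<open>N\<close> is congruent to a multiple of \<open>N^2\<close>, so dividing by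
  \<open>N^2\<close> leaves polynomial coefficients, and only the term from \<open>b\<close> keeps a
  denominator.\<close>

lemma automatic_residue_unit_case:
  assumes k: "k \<ge> 2" "l dvd k" and M: "M \<ge> 1" and f: "val_fps f"
    and b: "automatic_fps k b" "val_fps b" and B: "res_finite_ring B"
    and p: "\<And>i. i \<in> {1..d} \<Longrightarrow> poly_over B (p i)"
    and eq: "(1 - fps_X ^ M) * f \<approx> (\<Sum>i\<in>{1..d}. p i * fps_dilate (k ^ i) f) + b"
  shows "automatic_seq k (\<lambda>n. residue (f $ n))"
proof -
  have k0: "k > 0" and ki: "k ^ i > 0" and M0: "M > 0" for i using k M by auto
  define N :: "'a fps" where "N = 1 - fps_X ^ M"
  \<comment> \<open>The inverse of \<open>N\<close>, the geometric series in \<open>X^M\<close>; its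
    coefficients are 0 and 1, so division by \<open>N\<close> preserves integrality.\<close>
  define G :: "'a fps" where "G = fps_dilate M (Abs_fps (\<lambda>_. 1))"
  have NG: "N * G = 1"
  proof -
    have "N = fps_dilate M (1 - fps_X ^ 1)"
      unfolding N_def fps_dilate_diff[OF M0] fps_dilate_X_power[OF M0] fps_dilate_1[OF M0] by simp
    then have "N * G = fps_dilate M ((1 - fps_X) * Abs_fps (\<lambda>_. 1))"
      unfolding G_def fps_dilate_mult[OF M0] by simp
    also have "(1 - fps_X) * Abs_fps (\<lambda>_. 1 :: 'a) = 1"
      by (rule fps_ext) (simp add: left_diff_distrib fps_one_nth)
    finally show ?thesis by (simp add: fps_dilate_1[OF M0])
  qed
  have vG: "val_fps G" unfolding G_def
    by (intro val_fps_dilate M0) (simp add: val_fps_def one_in_val_ring)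
  have pN: "poly_over B N" unfolding N_def
    using poly_over_diff[OF B poly_over_X_power[OF B, of 0] poly_over_X_power[OF B, of M]] by simp
  have Bv: "B \<subseteq> val_ring" using B by (simp add: res_finite_ring_def)
  have vN: "val_fps N" by (rule poly_over_val_fps[OF pN Bv])
  have "\<exists>S. poly_over B S \<and> fps_dilate (k ^ i) N \<approx> N ^ 2 * S" if "i \<ge> 1" for i
  proof -
    have "l dvd k ^ i" using k(2) that by (simp add: dvd_trans[OF _ dvd_power])
    from one_diff_X_power_cong_square[OF B this, of M] show ?thesis
      unfolding N_def fps_dilate_diff[OF ki] fps_dilate_X_power[OF ki] fps_dilate_1[OF ki] by simp
  qed
  then obtain S where S: "\<And>i. i \<ge> 1 \<Longrightarrow> poly_over B (S i)"
    "\<And>i. i \<ge> 1 \<Longrightarrow> fps_dilate (k ^ i) N \<approx> N ^ 2 * S i" by metis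
  define h where "h = f * G"
  have vh: "val_fps h" unfolding h_def by (intro val_fps_mult f vG)
  have fh: "f = N * h" using NG by (simp add: h_def mult.left_commute)
  \<comment> \<open>The kernel of \<open>b\<close> as power series: finite and closed under
    sections, which lets the inhomogeneous term be absorbed as additional generators.\<close>
  define Ks where "Ks = Abs_fps ` automatic_kernel k (fps_nth b)"
  have Ks_fin: "finite Ks" using b(1) by (simp add: Ks_def automatic_seq_def)
  have Ks_b: "b \<in> Ks" unfolding Ks_def
    by (rule image_eqI[OF _ automatic_kernel_self]) (simp add: fps_nth_inverse)
  have Ks_section: "fps_section k r s \<in> Ks" if "s \<in> Ks" "r < k" for s r
  proof -
    obtain t where t: "s = Abs_fps t" "t \<in> automatic_kernel k (fps_nth b)"
      using \<open>s \<in> Ks\<close> unfolding Ks_def by blast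
    from automatic_kernel_section[OF t(2) \<open>r < k\<close>] show ?thesis
      unfolding Ks_def t(1) by (rule rev_image_eqI) (simp add: fps_section_def)
  qed
  have Ks_val: "val_fps s" if "s \<in> Ks" for s
    using that b(2) unfolding Ks_def automatic_kernel_def val_fps_def by auto
  \<comment> \<open>The generators \<open>s * G\<close> carry one denominator \<open>N\<close> only.
    The two in \<open>G^2 * b\<close> are lowered to one by passing to sections, as the next facts
    show.\<close>
  define X where "X = (\<lambda>i. fps_dilate (k ^ i) h) ` {..d} \<union> (\<lambda>s. s * G) ` Ks"
  have X_fin: "finite X" using Ks_fin by (simp add: X_def)
  let ?Y = "span_mod B (fps_dilate k ` X)"
  have base: "fps_dilate k x \<in> ?Y" if "x \<in> X" for x
    using that X_fin by (intro span_mod_base B) auto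
  have GN: "G ^ 2 * (N ^ 2 * x) = x" for x
  proof -
    have "G ^ 2 * (N ^ 2 * x) = (N * G) ^ 2 * x" by (simp add: power_mult_distrib algebra_simps)
    then show ?thesis by (simp add: NG)
  qed
  have vG2: "val_fps (G ^ 2)" using vG by (simp add: power2_eq_square val_fps_mult)
  have G2_dilate: "G ^ 2 * fps_dilate (k ^ i) (N * x) \<approx> S i * fps_dilate (k ^ i) x"
    if "i \<ge> 1" "val_fps x" for i x
  proof -
    have "fps_dilate (k ^ i) (N * x) \<approx> N ^ 2 * S i * fps_dilate (k ^ i) x"
      unfolding fps_dilate_mult[OF ki]
      using fps_cong_mult_left[OF S(2)[OF that(1)] val_fps_dilate[OF that(2) ki[of i]]] by (simp add: mult.commute)
    then have "G ^ 2 * fps_dilate (k ^ i) (N * x) \<approx> G ^ 2 * (N ^ 2 * S i * fps_dilate (k ^ i) x)"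
      using vG2 by (rule fps_cong_mult_left)
    then show ?thesis by (simp only: mult.assoc GN)
  qed
  have G2_Ks: "G ^ 2 * s \<in> ?Y" if s: "s \<in> Ks" for s
  proof -
    have "G ^ 2 * s = (\<Sum>r<k. fps_X ^ r * (G ^ 2 * fps_dilate k (fps_section k r s)))"
      by (subst fps_section_decompose[OF k0, of s]) (simp add: sum_distrib_left mult.left_commute)
    also have "\<dots> \<in> ?Y"
    proof (rule span_mod_sum[OF B], rule span_mod_mult[OF B _ poly_over_X_power[OF B]])
      fix r assume r: "r \<in> {..<k}"
      \<comment> \<open>Writing the section as \<open>N * t\<close> makes its dilation supply the
        \<open>N^2\<close> that cancels \<open>G^2\<close>.\<close>
      define t where "t = fps_section k r s * G"
      have t: "t \<in> X" "val_fps t" "fps_section k r s = N * t"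
        using Ks_section[OF s] Ks_val r NG vG
        by (auto simp: t_def X_def mult.left_commute intro: val_fps_mult)
      have "G ^ 2 * fps_dilate k (fps_section k r s) \<approx> S 1 * fps_dilate k t"
        using G2_dilate[of 1 t] t(2) unfolding t(3) by simp
      moreover have "S 1 * fps_dilate k t \<in> ?Y"
        by (intro span_mod_mult B base t S) simp
      ultimately show "G ^ 2 * fps_dilate k (fps_section k r s) \<in> ?Y"
        using span_mod_cong[OF B] by blast
    qed
    finally show ?thesis .
  qed
  have h_span: "h \<in> ?Y"
  proof -
    have "h = G ^ 2 * (N * f)" using GN[of h] by (simp add: fh power2_eq_square mult.assoc)
    also have "\<dots> \<approx> G ^ 2 * ((\<Sum>i\<in>{1..d}. p i * fps_dilate (k ^ i) f) + b)"
      using eq vG2 unfolding N_def by (intro fps_cong_mult_left)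
    finally have "h \<approx> (\<Sum>i\<in>{1..d}. p i * (G ^ 2 * fps_dilate (k ^ i) (N * h))) + G ^ 2 * b"
      unfolding fh[symmetric] by (simp add: distrib_left sum_distrib_left mult.left_commute)
    moreover have "(\<Sum>i\<in>{1..d}. p i * (G ^ 2 * fps_dilate (k ^ i) (N * h))) \<in> ?Y"
    proof (rule span_mod_sum[OF B], rule span_mod_mult[OF B _ p])
      fix i assume i: "i \<in> {1..d}"
      then obtain j where j: "i = Suc j" by (cases i) auto
      have "fps_dilate (k ^ i) h = fps_dilate k (fps_dilate (k ^ j) h)"
        unfolding j by (rule fps_dilate_iterate[OF k0, symmetric])
      moreover have "fps_dilate (k ^ j) h \<in> X" using i j by (auto simp: X_def)
      ultimately have "S i * fps_dilate (k ^ i) h \<in> ?Y"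
        using i by (auto intro!: span_mod_mult B base S)
      moreover have "G ^ 2 * fps_dilate (k ^ i) (N * h) \<approx> S i * fps_dilate (k ^ i) h"
        using i by (intro G2_dilate vh) simp
      ultimately show "G ^ 2 * fps_dilate (k ^ i) (N * h) \<in> ?Y"
        using span_mod_cong[OF B] by blast
    qed
    ultimately show ?thesis using span_mod_cong[OF B] span_mod_add[OF B] G2_Ks[OF Ks_b] by blast
  qed
  show ?thesis
  proof (rule automatic_residue_of_span[OF B k(1) X_fin])
    show "val_fps x" if "x \<in> X" for x
      using that vh vG Ks_val by (auto simp: X_def intro!: val_fps_dilate val_fps_mult ki)
    have "0 \<in> {..d}" by simp
    then have "fps_dilate (k ^ 0) h \<in> X" unfolding X_def by blast
    then have "h \<in> X" using fps_dilate_one[of h] by simp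
    then show "f \<in> span_mod B X" unfolding fh by (intro span_mod_mult span_mod_base B X_fin pN)
    show "x \<in> ?Y" if x: "x \<in> X" for x
    proof -
      consider i where "i \<le> d" "x = fps_dilate (k ^ i) h" | s where "s \<in> Ks" "x = s * G"
        using x unfolding X_def by auto
      then show ?thesis
      proof cases
        case 1
        show ?thesis
        proof (cases i)
          case 0
          then show ?thesis using 1 h_span fps_dilate_one[of h] by simp
        next
          case (Suc j)
          have "fps_dilate (k ^ j) h \<in> X" using 1(1) Suc by (auto simp: X_def)
          from base[OF this] show ?thesis unfolding 1(2) Suc fps_dilate_iterate[OF k0] .
        qed
      next
        case 2
        \<comment> \<open>Multiplying by \<open>N * G = 1\<close> reduces this generator to the case
          of \<open>G^2 * s\<close>.\<close>
        have "x = (N * G) * (s * G)" by (simp add: NG 2(2))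
        also have "\<dots> = N * (G ^ 2 * s)" by (simp add: power2_eq_square algebra_simps)
        also have "\<dots> \<in> ?Y" by (rule span_mod_mult[OF B G2_Ks[OF 2(1)] pN])
        finally show ?thesis .
      qed
    qed
  qed
qed

text \<open>Pigeonhole: the powers of \<open>X\<close> take finitely many values modulo \<open>c\<close> over the finite residue field.\<close>

lemma multiple_cong_binomial:
  assumes B: "res_finite_ring B" and c: "poly_over B c" "c $ n0 \<notin> I"
    and inv: "\<And>n. c $ n \<notin> I \<Longrightarrow> inverse (c $ n) \<in> B"
  shows "\<exists>q u M. poly_over B q \<and> M \<ge> 1 \<and> q * c \<approx> fps_X ^ u * (1 - fps_X ^ M)"
proof -
  note closed = B_closed[OF B]
  note B0 = closed_diff_mult_0[OF closed] and Bd = closed_diff_mult_diff[OF closed]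
    and Bm = closed_diff_mult_mult[OF closed]
  have Bv: "B \<subseteq> val_ring" using B by (simp add: res_finite_ring_def)
  obtain D where D: "\<And>n. c $ n \<in> B" "\<And>n. n > D \<Longrightarrow> c $ n = 0" using c(1) by (auto simp: poly_over_def)
  \<comment> \<open>The degree of \<open>c\<close> modulo the place. Higher coefficients of
    \<open>c\<close> may be nonzero in the field, but they lie in \<open>I\<close>.\<close>
  define m where "m = Max {n. c $ n \<notin> I}"
  have "{n. c $ n \<notin> I} \<subseteq> {..D}" using D(2) I_0 by (metis (mono_tags) atMost_iff linorder_not_less mem_Collect_eq subsetI)
  then have fin: "finite {n. c $ n \<notin> I}" by (rule finite_subset) simp
  have m: "c $ m \<notin> I" using Max_in[OF fin] c(2) unfolding m_def by blast
  have above: "c $ n \<in> I" if "n > m" for n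
    using Max_ge[OF fin, of n] that unfolding m_def by (meson leD mem_Collect_eq)
  define t where "t = inverse (c $ m)"
  have "c $ m \<noteq> 0" using m I_0 by metis
  then have tB: "t \<in> B" and tm: "t * c $ m = 1" using inv[OF m] by (simp_all add: t_def)
  \<comment> \<open>A single division step suffices: \<open>X\<close> times a remainder of degree
    below \<open>m\<close> has degree at most \<open>m\<close>.\<close>
  have reduce: "\<exists>q r. poly_over B q \<and> (\<forall>i. r $ i \<in> B) \<and> (\<forall>i\<ge>m. r $ i = 0) \<and> g \<approx> q * c + r"
    if g: "\<And>i. g $ i \<in> B" "\<And>i. i > m \<Longrightarrow> g $ i = 0" for g
  proof -
    define r where "r = fps_cutoff m (g - fps_const (g $ m * t) * c)"
    have "g $ i - (fps_const (g $ m * t) * c + r) $ i \<in> I" for i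
    proof -
      consider "i < m" | "i = m" | "i > m" by linarith
      then show ?thesis
      proof cases
        case 2
        have "g $ i - (fps_const (g $ m * t) * c + r) $ i = g $ m - g $ m * (t * c $ m)"
          by (simp add: r_def 2 mult.assoc)
        then show ?thesis unfolding tm using I_0 by simp
      next
        case 3
        then have "g $ i - (fps_const (g $ m * t) * c + r) $ i = - (g $ m * t * c $ i)"
          using g(2) by (simp add: r_def)
        then show ?thesis using Bv g(1) tB above[OF 3] by (auto intro!: I_minus val_ring_I_mult val_ring_mult)
      qed (simp add: r_def I_0)
    qed
    then have "g \<approx> fps_const (g $ m * t) * c + r" by (simp add: fps_cong_def)
    moreover have "\<forall>i. r $ i \<in> B" "\<forall>i\<ge>m. r $ i = 0" using g(1) tB D(1) B0 by (auto simp: r_def intro!: Bd Bm)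
    moreover have "poly_over B (fps_const (g $ m * t))" by (intro poly_over_const B Bm g tB)
    ultimately show ?thesis by blast
  qed
  have "\<exists>q r. poly_over B q \<and> (\<forall>i. r $ i \<in> B) \<and> (\<forall>i\<ge>m. r $ i = 0) \<and> fps_X ^ n \<approx> q * c + r" for n
  proof (induction n)
    case 0
    show ?case using B_0[OF B] B_1[OF B] by (intro reduce) (auto simp: fps_one_nth)
  next
    case (Suc n)
    then obtain q r where h: "poly_over B q" "\<forall>i. r $ i \<in> B" "\<forall>i\<ge>m. r $ i = 0" "fps_X ^ n \<approx> q * c + r" by blast
    obtain q' r' where h': "poly_over B q'" "\<forall>i. r' $ i \<in> B" "\<forall>i\<ge>m. r' $ i = 0" "fps_X ^ 1 * r \<approx> q' * c + r'"
    proof -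
      have "\<exists>q r'. poly_over B q \<and> (\<forall>i. r' $ i \<in> B) \<and> (\<forall>i\<ge>m. r' $ i = 0) \<and> fps_X ^ 1 * r \<approx> q * c + r'"
        using h B0 by (intro reduce) auto
      then show ?thesis using that by blast
    qed
    have "fps_X ^ Suc n \<approx> fps_X ^ 1 * (q * c) + fps_X ^ 1 * r"
      using fps_cong_mult_left[OF h(4) val_fps_X_power[of 1]] by (simp add: distrib_left)
    also have "\<dots> \<approx> fps_X ^ 1 * (q * c) + (q' * c + r')"
      by (intro fps_cong_add fps_cong_refl h')
    also have "\<dots> = (fps_X ^ 1 * q + q') * c + r'" by (simp add: algebra_simps)
    finally have "fps_X ^ Suc n \<approx> (fps_X ^ 1 * q + q') * c + r'" .
    moreover have "poly_over B (fps_X ^ 1 * q + q')"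
      by (intro poly_over_add poly_over_mult poly_over_X_power B h h')
    ultimately show ?case using h' by blast
  qed
  then have "\<forall>n. \<exists>q r. poly_over B q \<and> (\<forall>i. r $ i \<in> B) \<and> (\<forall>i\<ge>m. r $ i = 0) \<and> fps_X ^ n \<approx> q * c + r" by blast
  then obtain q r where q: "\<And>n. poly_over B (q n)" "\<And>n. fps_X ^ n \<approx> q n * c + r n"
    and r: "\<And>n i. r n $ i \<in> B" "\<And>n i. i \<ge> m \<Longrightarrow> r n $ i = 0" by metis
  define F where "F n = restrict (\<lambda>i. residue (r n $ i)) {..<m}" for n
  have "range F \<subseteq> {..<m} \<rightarrow>\<^sub>E residue ` B" using r(1) by (auto simp: F_def)
  then have "finite (range F)" by (rule finite_subset) (intro finite_PiE finite_lessThan B_fin B)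
  then have "\<not> inj F" using finite_imageD[of F UNIV] infinite_UNIV_nat by blast
  then obtain n1 n2 where n: "n1 < n2" "F n1 = F n2" unfolding inj_def by (metis linorder_neqE_nat)
  have "r n1 \<approx> r n2"
    unfolding fps_cong_def
  proof
    fix i
    show "r n1 $ i - r n2 $ i \<in> I"
    proof (cases "i < m")
      case True
      then have "residue (r n1 $ i) = residue (r n2 $ i)" using fun_cong[OF n(2), of i] by (simp add: F_def)
      then show ?thesis by (simp add: residue_eq_iff)
    qed (simp add: r(2) I_0)
  qed
  have "fps_X ^ n1 - fps_X ^ n2 \<approx> (q n1 * c + r n1) - (q n2 * c + r n2)" by (intro fps_cong_diff q)
  also have "\<dots> = (q n1 - q n2) * c + (r n1 - r n2)" by (simp add: algebra_simps)
  also have "\<dots> \<approx> (q n1 - q n2) * c + (r n2 - r n2)"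
    by (intro fps_cong_add fps_cong_diff fps_cong_refl \<open>r n1 \<approx> r n2\<close>)
  also have "\<dots> = (q n1 - q n2) * c" by simp
  finally have "fps_X ^ n1 - fps_X ^ n2 \<approx> (q n1 - q n2) * c" .
  moreover have "fps_X ^ n1 - fps_X ^ n2 = (fps_X ^ n1 * (1 - fps_X ^ (n2 - n1)) :: 'a fps)"
    using n(1) by (simp add: right_diff_distrib flip: power_add)
  ultimately have "(q n1 - q n2) * c \<approx> fps_X ^ n1 * (1 - fps_X ^ (n2 - n1))"
    by (metis fps_cong_sym)
  moreover have "poly_over B (q n1 - q n2)" by (intro poly_over_diff B q)
  ultimately show ?thesis using n(1) by (intro exI[of _ "q n1 - q n2"] exI[of _ n1] exI[of _ "n2 - n1"]) simp
qed

text \<open>A polynomial multiple turns \<open>p 0\<close> into \<open>X^u * (1 - X^M)\<close>. The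
  factor \<open>X^u\<close> is then removed by dropping the first \<open>u\<close> coefficients of
  \<open>f\<close>, which gives the case already treated.\<close>

lemma automatic_residue_nonzero_case:
  assumes k: "k \<ge> 2" "l dvd k" and f: "val_fps f"
    and b: "automatic_fps k b" "val_fps b"
    and p: "\<And>i. i \<le> d \<Longrightarrow> poly_over val_ring (p i)" and p0: "p 0 $ n0 \<notin> I"
    and eq: "(\<Sum>i\<le>d. p i * fps_dilate (k ^ i) f) \<approx> b"
  shows "automatic_seq k (\<lambda>n. residue (f $ n))"
proof -
  have k0: "k > 0" and ki: "k ^ i > 0" for i using k by auto
  have "\<forall>i\<in>{..d}. \<exists>D. \<forall>n>D. p i $ n = 0" using p by (auto simp: poly_over_def)
  from bchoice[OF this] obtain D where "\<forall>i\<in>{..d}. \<forall>n>D i. p i $ n = 0" ..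
  then have D: "\<And>i n. i \<le> d \<Longrightarrow> n > D i \<Longrightarrow> p i $ n = 0" by simp
  \<comment> \<open>All coefficients of the equation; the ring \<open>B\<close> chosen below also
    contains the inverses of those outside \<open>I\<close>, as division by \<open>p 0\<close>
    requires.\<close>
  define C where "C = insert 0 (\<Union>i\<le>d. fps_nth (p i) ` {..D i})"
  have C: "p i $ n \<in> C" if "i \<le> d" for i n
    using D[OF that, of n] that by (cases "n > D i") (auto simp: C_def not_less)
  have "finite C" by (simp add: C_def)
  have "C \<subseteq> val_ring" using p by (auto simp: C_def val_ring_0 poly_over_def)
  then have "C \<union> inverse ` (C - I) \<subseteq> val_ring" using inverse_in_val_ring by auto
  with \<open>finite C\<close> obtain B where B: "res_finite_ring B" "C \<union> inverse ` (C - I) \<subseteq> B"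
    using res_finite_ring_containing[of "C \<union> inverse ` (C - I)"] by blast
  have Bv: "B \<subseteq> val_ring" using B by (simp add: res_finite_ring_def)
  have pB: "poly_over B (p i)" if "i \<le> d" for i
    unfolding poly_over_def using C[OF that] B(2) D[OF that] by blast
  obtain q u M where q: "poly_over B q" "M \<ge> 1" "q * p 0 \<approx> fps_X ^ u * (1 - fps_X ^ M)"
    using multiple_cong_binomial[OF B(1) pB[of 0] p0] C[of 0] B(2) by blast
  have vq: "val_fps q" by (rule poly_over_val_fps[OF q(1) Bv])
  define N :: "'a fps" where "N = 1 - fps_X ^ M"
  define P where "P i = 0 - q * p i" for i
  have PB: "poly_over B (P i)" if "i \<le> d" for i
    unfolding P_def using that by (intro poly_over_diff poly_over_mult poly_over_0 B pB q)
  have XNB: "poly_over B (fps_X ^ u * N)"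
    unfolding N_def using poly_over_X_power[OF B(1), of 0]
    by (intro poly_over_mult poly_over_diff poly_over_X_power B) simp
  have eq1: "fps_X ^ u * N * f \<approx> (\<Sum>i\<in>{1..d}. P i * fps_dilate (k ^ i) f) + q * b"
  proof -
    have "(\<Sum>i\<le>d. p i * fps_dilate (k ^ i) f) = p 0 * f + (\<Sum>i\<in>{1..d}. p i * fps_dilate (k ^ i) f)"
      using fps_dilate_one[of f] by (simp add: atMost_atLeast0 sum.atLeast_Suc_atMost)
    then have e: "q * p 0 * f = (\<Sum>i\<in>{1..d}. P i * fps_dilate (k ^ i) f) + q * (\<Sum>i\<le>d. p i * fps_dilate (k ^ i) f)"
      by (simp add: P_def distrib_left sum_distrib_left sum_negf mult.assoc)
    have "fps_X ^ u * N * f \<approx> q * p 0 * f"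
      using fps_cong_mult_left[OF fps_cong_sym[OF q(3)] f] by (simp add: N_def mult.commute)
    also have "\<dots> \<approx> (\<Sum>i\<in>{1..d}. P i * fps_dilate (k ^ i) f) + q * b"
      unfolding e by (intro fps_cong_add fps_cong_refl fps_cong_mult_left eq vq)
    finally show ?thesis .
  qed
  \<comment> \<open>Substituting \<open>f = t + X^u * g\<close> gives
    \<open>X^(2 * u) * N * g\<close> on the left and at least \<open>X^(2 * u)\<close> in each
    dilated term, because \<open>k^i >= 2\<close>. All contributions of \<open>t\<close> go into
    \<open>b'\<close>, and shifting by \<open>2 * u\<close> needs no divisibility of
    \<open>b'\<close>.\<close>
  define t g where "t = fps_cutoff u f" and "g = fps_shift u f"
  have ft: "f = t + fps_X ^ u * g" unfolding t_def g_def by (metis add.commute fps_shift_cutoff')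
  define b' where "b' = q * b + (\<Sum>i\<in>{1..d}. P i * fps_dilate (k ^ i) t) - fps_X ^ u * N * t"
  define P' where "P' i = fps_X ^ (k ^ i * u - 2 * u) * P i" for i
  have P': "fps_X ^ (k ^ i * u) * P i = fps_X ^ (2 * u) * P' i" if "i \<in> {1..d}" for i
  proof -
    have "k ^ 1 \<le> k ^ i" using that k by (intro power_increasing) auto
    then have "2 * u \<le> k ^ i * u" using k(1) by (intro mult_le_mono1) simp
    then show ?thesis by (simp add: P'_def flip: power_add mult.assoc)
  qed
  have e1: "fps_X ^ u * N * f = fps_X ^ u * N * t + fps_X ^ (2 * u) * (N * g)"
    unfolding ft mult_2 power_add by (simp only: distrib_left mult.assoc mult.left_commute)
  have "(\<Sum>i\<in>{1..d}. P i * fps_dilate (k ^ i) f) =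
      (\<Sum>i\<in>{1..d}. P i * fps_dilate (k ^ i) t + fps_X ^ (2 * u) * (P' i * fps_dilate (k ^ i) g))"
  proof (rule sum.cong[OF refl])
    fix i assume i: "i \<in> {1..d}"
    have "P i * fps_dilate (k ^ i) f = P i * fps_dilate (k ^ i) t + fps_X ^ (k ^ i * u) * P i * fps_dilate (k ^ i) g"
      by (simp add: ft fps_dilate_add[OF ki] fps_dilate_mult[OF ki] fps_dilate_X_power[OF ki] algebra_simps)
    then show "P i * fps_dilate (k ^ i) f = P i * fps_dilate (k ^ i) t + fps_X ^ (2 * u) * (P' i * fps_dilate (k ^ i) g)"
      unfolding P'[OF i] by (simp add: mult.assoc)
  qed
  then have e2: "(\<Sum>i\<in>{1..d}. P i * fps_dilate (k ^ i) f) =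
      (\<Sum>i\<in>{1..d}. P i * fps_dilate (k ^ i) t) + fps_X ^ (2 * u) * (\<Sum>i\<in>{1..d}. P' i * fps_dilate (k ^ i) g)"
    by (simp add: sum.distrib sum_distrib_left)
  have "fps_X ^ (2 * u) * (N * g) = fps_X ^ u * N * f - fps_X ^ u * N * t" by (simp add: e1)
  also have "\<dots> \<approx> (\<Sum>i\<in>{1..d}. P i * fps_dilate (k ^ i) f) + q * b - fps_X ^ u * N * t"
    by (intro fps_cong_diff eq1 fps_cong_refl)
  also have "\<dots> = fps_X ^ (2 * u) * (\<Sum>i\<in>{1..d}. P' i * fps_dilate (k ^ i) g) + b'"
    unfolding e2 b'_def by simp
  finally have "fps_shift (2 * u) (fps_X ^ (2 * u) * (N * g)) \<approx>
      fps_shift (2 * u) (fps_X ^ (2 * u) * (\<Sum>i\<in>{1..d}. P' i * fps_dilate (k ^ i) g) + b')"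
    by (rule fps_cong_shift)
  then have eq2: "(1 - fps_X ^ M) * g \<approx> (\<Sum>i\<in>{1..d}. P' i * fps_dilate (k ^ i) g) + fps_shift (2 * u) b'"
    by (simp add: fps_shift_add N_def mult.commute[of "fps_X ^ (2 * u)"] fps_shift_times_fps_X_power')
  have vt: "val_fps t" "val_fps g" using f by (auto simp: val_fps_def t_def g_def val_ring_0)
  have auto_t: "automatic_fps k t" by (rule automatic_fps_poly[OF k(1), of u]) (simp add: t_def)
  have auto_mult: "automatic_fps k (c * s)" if "poly_over B c" "automatic_fps k s" for c s
    using that automatic_fps_poly_mult[OF that(2) k(1)] by (auto simp: poly_over_def)
  have "b' = q * b + (\<Sum>i\<in>{1..d}. P i * fps_dilate (k ^ i) t) + (0 - fps_X ^ u * N) * t"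
    by (simp add: b'_def)
  moreover have "automatic_fps k \<dots>"
    by (intro automatic_fps_add automatic_fps_sum auto_mult automatic_fps_dilate_power poly_over_diff
        poly_over_0 auto_t k0 b q PB B XNB) simp
  ultimately have "automatic_fps k b'" by simp
  then have ab: "automatic_fps k (fps_shift (2 * u) b')" by (rule automatic_fps_shift)
  have "val_fps b'" unfolding b'_def
    by (intro val_fps_diff val_fps_add val_fps_mult val_fps_sum val_fps_dilate ki vt b vq
        poly_over_val_fps[OF PB Bv] val_fps_X_power poly_over_val_fps[OF XNB Bv]
        val_fps_mult[OF poly_over_val_fps[OF XNB Bv]]) auto
  then have vb: "val_fps (fps_shift (2 * u) b')" by (rule val_fps_shift)
  have "automatic_seq k (\<lambda>n. residue (g $ n))"
    by (rule automatic_residue_unit_case[OF k q(2) vt(2) ab vb B(1) _ eq2])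
      (auto simp: P'_def intro!: poly_over_mult poly_over_X_power B PB)
  then show ?thesis using automatic_seq_add_index_imp[of k "\<lambda>n. residue (f $ n)" u] k(1) by (simp add: g_def)
qed

text \<open>If the lowest coefficient vanishes modulo the place, all remaining terms are dilated by
  \<open>k\<close>; a section strips one dilation from each and lowers the order
  \<open>d\<close>.\<close>

theorem automatic_residue:
  assumes k: "k \<ge> 2" "l dvd k" and f: "val_fps f"
    and b: "automatic_fps k b" "val_fps b"
    and p: "\<And>i. i \<le> d \<Longrightarrow> poly_over val_ring (p i)" and p0: "i0 \<le> d" "p i0 $ n0 \<notin> I"
    and eq: "(\<Sum>i\<le>d. p i * fps_dilate (k ^ i) f) \<approx> b"
  shows "automatic_seq k (\<lambda>n. residue (f $ n))"
  using b p p0 eq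
proof (induction d arbitrary: b p i0 n0)
  case 0
  then show ?case using automatic_residue_nonzero_case[OF k f, of b 0 p] by auto
next
  case (Suc d)
  show ?case
  proof (cases "\<exists>n. p 0 $ n \<notin> I")
    case True
    then show ?thesis using automatic_residue_nonzero_case[OF k f Suc.prems(1,2), of "Suc d" p] Suc.prems by blast
  next
    case False
    have k0: "k > 0" using k by simp
    obtain i1 where i1: "i0 = Suc i1" using Suc.prems(5) False by (cases i0) auto
    \<comment> \<open>The digit of \<open>n0\<close> is chosen so that the coefficient outside
      \<open>I\<close> survives the section.\<close>
    define r where "r = n0 mod k"
    have r: "r < k" using k0 by (simp add: r_def)
    have "p 0 \<approx> 0" using False by (simp add: fps_cong_def)
    from fps_cong_mult_left[OF this f] have "p 0 * f \<approx> 0" by (simp add: mult.commute)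
    moreover have "(\<Sum>i\<le>Suc d. p i * fps_dilate (k ^ i) f) =
        p 0 * f + (\<Sum>i\<le>d. p (Suc i) * fps_dilate k (fps_dilate (k ^ i) f))"
      unfolding fps_dilate_iterate[OF k0] sum.atMost_Suc_shift using fps_dilate_one[of f] by simp
    ultimately have "(\<Sum>i\<le>d. p (Suc i) * fps_dilate k (fps_dilate (k ^ i) f)) \<approx> b"
      using fps_cong_diff[OF Suc.prems(6), of "p 0 * f" 0] by simp
    from fps_cong_section[OF this, of k r]
    have "fps_section k r (\<Sum>i\<le>d. p (Suc i) * fps_dilate k (fps_dilate (k ^ i) f)) \<approx> fps_section k r b" .
    also have "fps_section k r (\<Sum>i\<le>d. p (Suc i) * fps_dilate k (fps_dilate (k ^ i) f)) =
        (\<Sum>i\<le>d. fps_section k r (p (Suc i) * fps_dilate k (fps_dilate (k ^ i) f)))"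
      by (simp add: fps_eq_iff fps_sum_nth)
    also have "\<dots> = (\<Sum>i\<le>d. fps_section k r (p (Suc i)) * fps_dilate (k ^ i) f)"
      by (intro sum.cong refl fps_section_mult_dilate k0 r)
    finally have eq': "(\<Sum>i\<le>d. fps_section k r (p (Suc i)) * fps_dilate (k ^ i) f) \<approx> fps_section k r b" .
    show ?thesis
    proof (rule Suc.IH[OF _ _ _ _ _ eq'])
      show "automatic_fps k (fps_section k r b)"
        by (rule automatic_fps_section[OF Suc.prems(1) r])
      show "val_fps (fps_section k r b)" using Suc.prems(2) by (rule val_fps_section)
      show "i1 \<le> d" using Suc.prems(4) i1 by simp
      show "fps_section k r (p (Suc i1)) $ (n0 div k) \<notin> I"
        using Suc.prems(5) by (simp add: i1 r_def)
      show "poly_over val_ring (fps_section k r (p (Suc i)))" if i: "i \<le> d" for i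
      proof -
        obtain D where D: "\<forall>n. p (Suc i) $ n \<in> val_ring" "\<forall>n>D. p (Suc i) $ n = 0"
          using Suc.prems(3)[of "Suc i"] i by (auto simp: poly_over_def)
        have "p (Suc i) $ (k * n + r) = 0" if "n > D" for n
        proof -
          have "1 * n \<le> k * n" using k0 by (intro mult_le_mono1) simp
          then have "k * n + r > D" using that by linarith
          then show ?thesis using D(2) by blast
        qed
        then show ?thesis using D(1) by (auto simp: poly_over_def)
      qed
    qed
  qed
qed

end

subsection \<open>Finite-valued Mahler sequences\<close>

text \<open>The equation may be divided by a coefficient \<open>u\<close> of largest absolute value,
  so its coefficients become integral and one of them is 1. Inserting the decomposition of
  \<open>f\<close> moves the part from \<open>c\<close> to the right as the inhomogeneous
  term.\<close>

lemma (in residue_place) automatic_residue_mahler: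
  assumes k: "k \<ge> 2" "l dvd k" and f: "mahler_fps k f"
    and decomp: "f = fps_const s * g + c" "s \<noteq> 0" "automatic_fps k c" "val_fps g"
  shows "automatic_seq k (\<lambda>n. residue (g $ n))"
proof -
  have k0: "k > 0" and ki: "k ^ i > 0" for i using k by auto
  obtain d p where p: "\<exists>i\<le>d. p i \<noteq> 0" "(\<Sum>i\<le>d. fps_of_poly (p i) * fps_dilate (k ^ i) f) = 0"
    using f unfolding mahler_fps_def fps_dilate_def by blast
  define C where "C = (\<Union>i\<le>d. coeff (p i) ` {..degree (p i)})"
  have C: "coeff (p i) n \<in> insert 0 C" if "i \<le> d" for i n
    using that by (cases "n \<le> degree (p i)") (auto simp: C_def coeff_eq_0)
  have "\<exists>c\<in>C. c \<noteq> 0"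
  proof -
    obtain i where "i \<le> d" "p i \<noteq> 0" using p(1) by blast
    then show ?thesis unfolding C_def by (intro bexI[of _ "lead_coeff (p i)"]) auto
  qed
  moreover have "finite C" by (simp add: C_def)
  ultimately obtain u where u: "u \<in> C" "u \<noteq> 0" "\<forall>c\<in>C. c / u \<in> val_ring"
    using scale_into_val_ring[of C] by blast
  obtain i0 n0 where i0: "i0 \<le> d" "u = coeff (p i0) n0" using u(1) by (auto simp: C_def)
  define q where "q i = fps_const (1 / u) * fps_of_poly (p i)" for i
  have q_poly: "poly_over val_ring (q i)" if "i \<le> d" for i
    unfolding poly_over_def
  proof
    show "\<forall>n. q i $ n \<in> val_ring"
    proof
      fix n
      have "coeff (p i) n / u \<in> val_ring" using C[OF that, of n] u(3) val_ring_0 by auto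
      then show "q i $ n \<in> val_ring" by (simp add: q_def)
    qed
    show "\<exists>D. \<forall>n>D. q i $ n = 0" by (intro exI[of _ "degree (p i)"]) (simp add: q_def coeff_eq_0)
  qed
  have q1: "q i0 $ n0 = 1" using u(2) by (simp add: q_def i0(2)[symmetric])
  define b where "b = fps_const (- 1 / s) * (\<Sum>i\<le>d. q i * fps_dilate (k ^ i) c)"
  have dil: "fps_dilate (k ^ i) f = fps_const s * fps_dilate (k ^ i) g + fps_dilate (k ^ i) c" for i
    using ki[of i] unfolding decomp(1) by (intro fps_ext) (simp add: fps_dilate_nth)
  have "(\<Sum>i\<le>d. q i * fps_dilate (k ^ i) f) = fps_const (1 / u) * (\<Sum>i\<le>d. fps_of_poly (p i) * fps_dilate (k ^ i) f)"
    by (simp add: q_def sum_distrib_left mult.assoc)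
  then have "(\<Sum>i\<le>d. q i * fps_dilate (k ^ i) f) = 0" by (simp add: p(2))
  then have "fps_const s * (\<Sum>i\<le>d. q i * fps_dilate (k ^ i) g) + (\<Sum>i\<le>d. q i * fps_dilate (k ^ i) c) = 0"
    unfolding dil by (simp add: distrib_left sum.distrib sum_distrib_left mult.left_commute)
  then have "fps_const s * (\<Sum>i\<le>d. q i * fps_dilate (k ^ i) g) = - (\<Sum>i\<le>d. q i * fps_dilate (k ^ i) c)"
    by (simp add: eq_neg_iff_add_eq_0)
  then have "fps_const (1 / s) * (fps_const s * (\<Sum>i\<le>d. q i * fps_dilate (k ^ i) g)) =
      fps_const (1 / s) * - (\<Sum>i\<le>d. q i * fps_dilate (k ^ i) c)" by simp
  also have "\<dots> = b" by (intro fps_ext) (simp add: b_def)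
  also have "fps_const (1 / s) * (fps_const s * (\<Sum>i\<le>d. q i * fps_dilate (k ^ i) g)) = (\<Sum>i\<le>d. q i * fps_dilate (k ^ i) g)"
    using decomp(2) by (intro fps_ext) simp
  finally have eq: "(\<Sum>i\<le>d. q i * fps_dilate (k ^ i) g) = b" .
  have "automatic_fps k (q i * fps_dilate (k ^ i) c)" if "i \<le> d" for i
    using q_poly[OF that] automatic_fps_poly_mult[OF automatic_fps_dilate_power[OF decomp(3) k0] k(1)]
    by (auto simp: poly_over_def)
  then have "automatic_fps k b" unfolding b_def
    by (intro automatic_fps_const_mult automatic_fps_sum) simp
  \<comment> \<open>The factor \<open>1 / s\<close> in \<open>b\<close> need not be integral;
    integrality is read off from the other side of the equation.\<close>
  moreover have "val_fps b" unfolding eq[symmetric]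
    by (intro val_fps_sum val_fps_mult val_fps_dilate ki decomp poly_over_val_fps[OF q_poly]) auto
  moreover have "(\<Sum>i\<le>d. q i * fps_dilate (k ^ i) g) \<approx> b" unfolding eq by (rule fps_cong_refl)
  ultimately show ?thesis
    using automatic_residue[OF k decomp(4), of b d q i0 n0] q_poly q1 one_notin_I i0(1) by auto
qed

text \<open>Pairing \<open>\<rho>\<close> with the residue of the rescaled difference gives a finer
  automatic labeling \<open>\<pi>\<close>. Choosing one value in each class of \<open>\<pi>\<close>
  makes it a relabeling again, and an idempotent one because the chosen value has the same
  label.\<close>

lemma (in residue_place) refine_automatic_relabeling:
  fixes a :: "nat \<Rightarrow> 'a"
  assumes k: "k \<ge> 2" "l dvd k" and f: "mahler_fps k (Abs_fps a)" and fin: "finite (range a)"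
    and \<rho>: "automatic_seq k (\<lambda>n. \<rho> (a n))" "\<And>x. x \<in> range a \<Longrightarrow> \<rho> x \<in> range a"
      "\<And>x. x \<in> range a \<Longrightarrow> \<rho> (\<rho> x) = \<rho> x"
    and x0: "x0 \<in> range a" "\<rho> x0 \<noteq> x0"
  shows "\<exists>\<rho>'. automatic_seq k (\<lambda>n. \<rho>' (a n)) \<and> (\<forall>x\<in>range a. \<rho>' x \<in> range a \<and> \<rho>' (\<rho>' x) = \<rho>' x) \<and>
    card (\<rho> ` range a) < card (\<rho>' ` range a)"
proof -
  let ?A = "range a"
  define C where "C = (\<lambda>x. x - \<rho> x) ` ?A"
  have "x0 - \<rho> x0 \<in> C" "x0 - \<rho> x0 \<noteq> 0" using x0 by (simp_all add: C_def)
  then have "\<exists>c\<in>C. c \<noteq> 0" by blast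
  moreover have "finite C" using fin by (simp add: C_def)
  ultimately obtain s where s: "s \<in> C" "s \<noteq> 0" "\<forall>c\<in>C. c / s \<in> val_ring"
    using scale_into_val_ring[of C] by blast
  obtain x1 where x1: "x1 \<in> ?A" "s = x1 - \<rho> x1" using s(1) by (auto simp: C_def)
  define \<sigma> where "\<sigma> x = residue ((x - \<rho> x) / s)" for x
  define \<pi> where "\<pi> x = (\<rho> x, \<sigma> x)" for x
  define pick where "pick v = (SOME y. y \<in> ?A \<and> \<pi> y = v)" for v
  define \<rho>' where "\<rho>' x = pick (\<pi> x)" for x
  have "automatic_seq k (\<lambda>n. residue (Abs_fps (\<lambda>n. (a n - \<rho> (a n)) / s) $ n))"
  proof (rule automatic_residue_mahler[OF k f])
    show "Abs_fps a = fps_const s * Abs_fps (\<lambda>n. (a n - \<rho> (a n)) / s) + Abs_fps (\<lambda>n. \<rho> (a n))"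
      using s(2) by (intro fps_ext) simp
    show "automatic_fps k (Abs_fps (\<lambda>n. \<rho> (a n)))" using \<rho>(1) by (simp add: Abs_fps_inverse)
    show "val_fps (Abs_fps (\<lambda>n. (a n - \<rho> (a n)) / s))" using s(3) by (simp add: val_fps_def C_def)
  qed (rule s(2))
  then have "automatic_seq k (\<lambda>n. \<sigma> (a n))" by (simp add: \<sigma>_def)
  from automatic_seq_map2[OF \<rho>(1) this, of Pair] have "automatic_seq k (\<lambda>n. \<pi> (a n))" by (simp add: \<pi>_def)
  from automatic_seq_map[OF this, of pick] have auto': "automatic_seq k (\<lambda>n. \<rho>' (a n))" by (simp add: \<rho>'_def)
  have pick: "\<rho>' x \<in> ?A \<and> \<pi> (\<rho>' x) = \<pi> x" if "x \<in> ?A" for x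
    unfolding \<rho>'_def pick_def by (rule someI[of _ x]) (use that in simp)
  then have idem: "\<rho>' x \<in> ?A \<and> \<rho>' (\<rho>' x) = \<rho>' x" if "x \<in> ?A" for x
    using that unfolding \<rho>'_def by (metis \<rho>'_def)
  have "card (\<rho> ` ?A) < card (\<pi> ` ?A)"
  proof -
    have img: "fst ` \<pi> ` ?A = \<rho> ` ?A" by (simp add: \<pi>_def image_image)
    have "\<not> inj_on fst (\<pi> ` ?A)"
    proof
      assume inj: "inj_on fst (\<pi> ` ?A)"
      \<comment> \<open>The value \<open>x1\<close> attains the scale \<open>s\<close>, so its
        rescaled difference is 1. Idempotence makes the difference at \<open>\<rho> x1\<close> equal
        to 0. Both values have the same \<open>\<rho>\<close>, yet their residues differ.\<close>
      have "fst (\<pi> x1) = fst (\<pi> (\<rho> x1))" using \<rho>(3)[OF x1(1)] by (simp add: \<pi>_def)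
      then have "\<pi> x1 = \<pi> (\<rho> x1)" using inj x1(1) \<rho>(2)[OF x1(1)] by (auto simp: inj_on_def)
      then have "residue 1 = residue 0" using s(2) \<rho>(3)[OF x1(1)] by (simp add: \<pi>_def \<sigma>_def x1(2)[symmetric])
      then show False using one_notin_I by (simp add: residue_eq_iff)
    qed
    then have "card (fst ` \<pi> ` ?A) \<noteq> card (\<pi> ` ?A)" using eq_card_imp_inj_on[of "\<pi> ` ?A" fst] fin by auto
    moreover have "card (fst ` \<pi> ` ?A) \<le> card (\<pi> ` ?A)" by (intro card_image_le finite_imageI fin)
    ultimately show ?thesis unfolding img by linarith
  qed
  also have "\<pi> ` ?A = \<pi> ` \<rho>' ` ?A" using pick by (simp add: image_image)
  also have "card \<dots> \<le> card (\<rho>' ` ?A)" by (intro card_image_le finite_imageI fin)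
  finally show ?thesis using auto' idem by blast
qed

lemma automatic_seq_of_finite_mahler:
  fixes a :: "nat \<Rightarrow> 'a::field_char_0"
  assumes k: "k \<ge> 2" and f: "mahler_fps k (Abs_fps a)" and fin: "finite (range a)"
  shows "automatic_seq k a"
proof -
  obtain l where l: "prime l" "l dvd k" using k prime_factor_nat[of k] by auto
  obtain I :: "'a set" where "residue_place I l" using residue_place_exists[OF l(1)] by blast
  then interpret residue_place I l .
  define R where "R \<rho> \<longleftrightarrow> automatic_seq k (\<lambda>n. \<rho> (a n)) \<and>
    (\<forall>x\<in>range a. \<rho> x \<in> range a \<and> \<rho> (\<rho> x) = \<rho> x)" for \<rho>
  \<comment> \<open>The constant relabeling starts the maximization; image sizes are bounded by the
    number of values.\<close>
  have "R (\<lambda>_. a 0)" by (simp add: R_def automatic_seq_const)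
  moreover have "\<forall>\<rho>. R \<rho> \<longrightarrow> card (\<rho> ` range a) \<le> card (range a)"
    using card_image_le[OF fin] by blast
  ultimately obtain \<rho> where \<rho>: "R \<rho>" "\<forall>\<rho>'. R \<rho>' \<longrightarrow> card (\<rho>' ` range a) \<le> card (\<rho> ` range a)"
    using Lattices_Big.ex_has_greatest_nat[of R "\<lambda>_. a 0" "\<lambda>\<rho>. card (\<rho> ` range a)" "Suc (card (range a))"]
    by (auto simp: less_Suc_eq_le)
  have "\<rho> x = x" if "x \<in> range a" for x
  proof (rule ccontr)
    assume "\<rho> x \<noteq> x"
    moreover from \<rho>(1) have "automatic_seq k (\<lambda>n. \<rho> (a n))"
      "\<And>x. x \<in> range a \<Longrightarrow> \<rho> x \<in> range a" "\<And>x. x \<in> range a \<Longrightarrow> \<rho> (\<rho> x) = \<rho> x"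
      unfolding R_def by blast+
    ultimately have "\<exists>\<rho>'. R \<rho>' \<and> card (\<rho> ` range a) < card (\<rho>' ` range a)"
      using refine_automatic_relabeling[OF k l(2) f fin, of \<rho> x] that unfolding R_def by blast
    then show False using \<rho>(2) by (meson leD)
  qed
  then have "(\<lambda>n. \<rho> (a n)) = a" by simp
  then show ?thesis using \<rho>(1) by (simp add: R_def)
qed

theorem theorem11p1:
  fixes f :: "'a::field_char_0 fps" and a :: "nat \<Rightarrow> 'a" and k :: nat
  assumes "k \<ge> 2"
    and "f = Abs_fps a"
    and "mahler_fps k f"
  shows "automatic_seq k a \<longleftrightarrow> finite {a n | n. n \<ge> 0}"
proof -
  have "{a n | n. n \<ge> 0} = range a" by auto
  then show ?thesis
    using automatic_seq_finite_range[of k a] automatic_seq_of_finite_mahler[of k a] assms by auto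
qed

end
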